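(* Assume that, for scalars $\alpha>0,\gamma>0,\rho>0$, $Z_d=\mathrm{diag}(\mu I_n,\beta I_n,\pi I_n,\kappa I_n)>0$ and matrices $S>0$, $P>0$, the following hold: $$\begin{bmatrix}A^TS+SA+\rho S & \bullet\\ \alpha^{-1}G_0^TE^TS & -\rho P\end{bmatrix}<0,$$ $$A_K^TP+PA_K+P\begin{bmatrix}E_0^T\\ F_0^T\\ G_0\\ G_0\end{bmatrix}^T Z_d\begin{bmatrix}E_0^T\\ F_0^T\\ G_0\\ G_0\end{bmatrix}P+\begin{bmatrix}BK\\ \gamma^{-1}G_0\\ \alpha^{-1}DG_0\\ 0\end{bmatrix}^T Z_d^{-1}\begin{bmatrix}BK\\ \gamma^{-1}G_0\\ \alpha^{-1}DG_0\\ 0\end{bmatrix}+\rho P<0,\qquad \begin{bmatrix}\rho S & \bullet\\ C_0 & \kappa I_n\end{bmatrix}>0.$$ Then there exists a nonempty residual set $\mathbb{X}\subset\mathbb{R}^r\times\mathbb{R}^{2n}$ such that i) $(0,0)$ lies in its interior and ii) it is attained in finite time from any initial condition $(\zeta_0,x_0)\notin\mathbb{X}$.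
   Context: Consider the system $\dot\zeta=A\zeta+E\sigma$, $\dot\sigma=C\zeta+D\sigma+Bu+f(t)$ with $\zeta\in\mathbb{R}^r$, $\sigma\in\mathbb{R}^n$, $u\in\mathbb{R}^m$, $A$ Hurwitz, $B$ full row rank, $\|\dot f(t)\|\le\delta$. The control is $u=K_0\zeta+c(\sigma)K_1\sigma+K_2\eta$, $\dot\eta=c(\sigma)^2\sigma$, $c(\sigma)=1/\sqrt{\|\sigma\|}+\alpha$. With $BK_2$ nonsingular, $z=\eta+(BK_2)^{-1}f$, $x=[\sigma^T~z^T]^T$, $K=[K_1~K_2]$, $R(\sigma)=\mathrm{diag}(c(\sigma)I_n,I_n)$, $A_0=\begin{bmatrix}0&0\\ I_n&0\end{bmatrix}$, $B_0=\begin{bmatrix}B\\0\end{bmatrix}$, $A_K=A_0+B_0K$, $E_0=[(1/2)I_n~0]^T$, $F_0=[0~I_n]^T$, $G_0=[I_n~0]$, $C_0=C+BK_0$, and $\delta=\|(BK_2)^{-1}\|^{-1}\gamma^{-1}$. Lyapunov functions $v(\zeta)=\zeta^TS\zeta$, $V(x)=x^TR(\sigma)PR(\sigma)x$, and $\nu(\zeta,x)=\max\{v(\zeta),V(x)\}$. *)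

theory Defs
  imports "HOL-Analysis.Analysis"
begin

section \<open>Matrix notions (real matrices as Cartesian types)\<close>

text \<open>Positive definiteness M > 0: symmetric, and x^T M x > 0 for x nonzero.
  Negative definiteness M < 0 means -M > 0.\<close>
definition pos_def :: "real^'n^'n \<Rightarrow> bool" where
  "pos_def M \<longleftrightarrow> transpose M = M \<and> (\<forall>x. x \<noteq> 0 \<longrightarrow> x \<bullet> (M *v x) > 0)"

definition neg_def :: "real^'n^'n \<Rightarrow> bool" where
  "neg_def M \<longleftrightarrow> pos_def (- M)"

text \<open>Hurwitz: every (complex) eigenvalue has negative real part.\<close>
definition hurwitz :: "real^'n^'n \<Rightarrow> bool" where
  "hurwitz A \<longleftrightarrow> (\<forall>(l::complex) (v::complex^'n). v \<noteq> 0 \<and>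
      (\<chi> i j. complex_of_real (A$i$j)) *v v = l *s v \<longrightarrow> Re l < 0)"

text \<open>Block matrices [[M11, M12],[M21, M22]] and vector concatenation.\<close>
definition block2 ::
  "'a::zero^'b^'r \<Rightarrow> 'a^'c^'r \<Rightarrow> 'a^'b^'s \<Rightarrow> 'a^'c^'s \<Rightarrow> 'a^('b + 'c)^('r + 's)" where
  "block2 M11 M12 M21 M22 = (\<chi> i j. case i of
      Inl i' \<Rightarrow> (case j of Inl j' \<Rightarrow> M11$i'$j' | Inr j' \<Rightarrow> M12$i'$j')
    | Inr i' \<Rightarrow> (case j of Inl j' \<Rightarrow> M21$i'$j' | Inr j' \<Rightarrow> M22$i'$j'))"

text \<open>Vertical stacking [M1; M2] and horizontal stacking [M1 M2].\<close>
definition vstack :: "'a^'c^'r \<Rightarrow> 'a^'c^'s \<Rightarrow> 'a^'c^('r + 's)" where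
  "vstack M1 M2 = (\<chi> i. case i of Inl i' \<Rightarrow> M1$i' | Inr i' \<Rightarrow> M2$i')"

definition hstack :: "'a^'b^'r \<Rightarrow> 'a^'c^'r \<Rightarrow> 'a^('b + 'c)^'r" where
  "hstack M1 M2 = (\<chi> i j. case j of Inl j' \<Rightarrow> M1$i$j' | Inr j' \<Rightarrow> M2$i$j')"

definition vcat :: "'a^'b \<Rightarrow> 'a^'c \<Rightarrow> 'a^('b + 'c)" where
  "vcat x y = (\<chi> i. case i of Inl i' \<Rightarrow> x$i' | Inr i' \<Rightarrow> y$i')"

section \<open>The matrices of the paper\<close>

definition A0 :: "real^('n::finite + 'n)^('n + 'n)" where
  "A0 = block2 0 0 (mat 1) 0"

definition B0 :: "real^'m^'n \<Rightarrow> real^'m^('n + 'n)" where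
  "B0 B = vstack B 0"

definition Kmat :: "real^'n^'m \<Rightarrow> real^'n^'m \<Rightarrow> real^('n + 'n)^'m" where
  "Kmat K1 K2 = hstack K1 K2"

definition AK :: "real^'m^'n \<Rightarrow> real^'n^'m \<Rightarrow> real^'n^'m \<Rightarrow> real^('n::finite + 'n)^('n + 'n)" where
  "AK B K1 K2 = A0 + B0 B ** Kmat K1 K2"

definition E0 :: "real^'n::finite^('n + 'n)" where
  "E0 = vstack ((1/2) *\<^sub>R mat 1) 0"

definition F0 :: "real^'n::finite^('n + 'n)" where
  "F0 = vstack 0 (mat 1)"

definition G0 :: "real^('n::finite + 'n)^'n" where
  "G0 = hstack (mat 1) 0"

definition C0 :: "real^'r^'n \<Rightarrow> real^'m^'n \<Rightarrow> real^'r^'m \<Rightarrow> real^'r^'n" where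
  "C0 C B K0 = C + B ** K0"

text \<open>Z_d = diag(mu I_n, beta I_n, piz I_n, kappa I_n).\<close>
definition Zd :: "real \<Rightarrow> real \<Rightarrow> real \<Rightarrow> real \<Rightarrow> real^(('n::finite + 'n) + ('n + 'n))^(('n + 'n) + ('n + 'n))" where
  "Zd mu beta piz kappa =
     block2 (block2 (mu *\<^sub>R mat 1) 0 0 (beta *\<^sub>R mat 1)) 0
            0 (block2 (piz *\<^sub>R mat 1) 0 0 (kappa *\<^sub>R mat 1))"

text \<open>The stacked matrix [E0^T; F0^T; G0; G0].\<close>
definition Mstack :: "real^('n::finite + 'n)^(('n + 'n) + ('n + 'n))" where
  "Mstack = vstack (vstack (transpose E0) (transpose F0)) (vstack G0 G0)"

text \<open>The stacked matrix [B K; gamma^-1 G0; alpha^-1 D G0; 0].\<close>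
definition Nstack :: "real^'m^'n \<Rightarrow> real^'n^'m \<Rightarrow> real^'n^'m \<Rightarrow> real^'n^'n \<Rightarrow> real \<Rightarrow> real
    \<Rightarrow> real^('n + 'n)^(('n + 'n) + ('n + 'n))" where
  "Nstack B K1 K2 D gamma alpha =
     vstack (vstack (B ** Kmat K1 K2) ((1/gamma) *\<^sub>R G0))
            (vstack ((1/alpha) *\<^sub>R (D ** G0)) 0)"

section \<open>Closed-loop dynamics\<close>

definition cgain :: "real \<Rightarrow> real^'n \<Rightarrow> real" where
  "cgain alpha s = 1 / sqrt (norm s) + alpha"

text \<open>Solutions of the closed-loop system on [0,oo), in the sense of Filippov:
  the trajectory is absolutely continuous (integral of a locally absolutely integrable
  derivative) and the derivative satisfies, for almost every t >= 0, the Filippov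
  regularization of the right-hand side.  The only discontinuity of the right-hand side
  is the term c(sg)^2 sg in the eta-equation at sg = 0, whose Filippov set there
  is the closed unit ball; the term c(sg) K1 sg extends continuously by 0.\<close>
definition closed_loop_solution ::
  "real^'r^'r \<Rightarrow> real^'n^'r \<Rightarrow> real^'r^'n \<Rightarrow> real^'n^'n \<Rightarrow> real^'m^'n
   \<Rightarrow> real^'r^'m \<Rightarrow> real^'n^'m \<Rightarrow> real^'n^'m \<Rightarrow> real \<Rightarrow> (real \<Rightarrow> real^'n)
   \<Rightarrow> (real \<Rightarrow> real^'r) \<Rightarrow> (real \<Rightarrow> real^'n) \<Rightarrow> (real \<Rightarrow> real^'n) \<Rightarrow> bool" where
  "closed_loop_solution A E C D B K0 K1 K2 alpha f zeta sg eta \<longleftrightarrow>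
    (\<exists>dzeta dsg deta.
      (\<forall>t\<ge>0. dzeta absolutely_integrable_on {0..t} \<and>
              dsg absolutely_integrable_on {0..t} \<and>
              deta absolutely_integrable_on {0..t} \<and>
              zeta t = zeta 0 + integral {0..t} dzeta \<and>
              sg t = sg 0 + integral {0..t} dsg \<and>
              eta t = eta 0 + integral {0..t} deta) \<and>
      (AE t in lborel. 0 \<le> t \<longrightarrow>
         dzeta t = A *v zeta t + E *v sg t \<and>
         (if sg t \<noteq> 0 then
            dsg t = C *v zeta t + D *v sg t
              + B *v (K0 *v zeta t + cgain alpha (sg t) *\<^sub>R (K1 *v sg t) + K2 *v eta t)
              + f t
            \<and> deta t = (cgain alpha (sg t))\<^sup>2 *\<^sub>R sg t
          else
            dsg t = C *v zeta t + D *v sg t + B *v (K0 *v zeta t + K2 *v eta t) + f t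
            \<and> norm (deta t) \<le> 1)))"

end

(* In the coordinates z = eta + (B K2)^-1 f the closed loop is the linear loop with constant
   gain alpha, perturbed by terms of size O(sqrt |sigma|): they come from c(sigma) - alpha =
   1/sqrt |sigma|, from the Filippov set of the integrator at sigma = 0 and from the bounded
   derivative of f. For the quadratic Lyapunov function V = zeta' S zeta + x' R P R x / alpha,
   with R = diag(alpha I, I), the three LMIs give V' <= -e |y|^2 + O(|y| + |y|^(3/2)) in the
   scaled state y. Hence V decreases at rate at least 1 outside a large sublevel set {V <= c};
   this set is the residual set, and it is reached in finite time because the nonnegative V
   cannot decrease at a fixed rate forever. Solutions are only absolutely continuous, so the
   decrease of V is obtained from integrals over short intervals instead of a chain rule. *)

theory Submission
  imports Defs
begin

section \<open>Block vectors and block matrices\<close>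

lemma vcat_nth: "vcat a b $ i = (case i of Inl i' \<Rightarrow> a $ i' | Inr i' \<Rightarrow> b $ i')"
  by (simp add: vcat_def)

lemma vcat_Inl [simp]: "vcat a b $ Inl i = a $ i"
  by (simp add: vcat_nth)

lemma vcat_Inr [simp]: "vcat a b $ Inr j = b $ j"
  by (simp add: vcat_nth)

lemma vcat_cases:
  obtains a b where "x = vcat a b"
  by (rule that[of "\<chi> i. x $ Inl i" "\<chi> i. x $ Inr i"]) (simp add: vec_eq_iff vcat_nth split: sum.split)

lemma vcat_add: "vcat a b + vcat c d = vcat (a + c) (b + d)"
  and vcat_diff: "vcat a b - vcat c d = vcat (a - c) (b - d)"
  and vcat_scaleR: "r *\<^sub>R vcat a b = vcat (r *\<^sub>R a) (r *\<^sub>R b)"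
  and vcat_eq_0_iff: "vcat a b = 0 \<longleftrightarrow> a = 0 \<and> b = 0"
  by (auto simp: vec_eq_iff vcat_nth split: sum.split)

lemma sum_UNIV_Plus:
  "(\<Sum>i\<in>(UNIV :: ('b::finite + 'c::finite) set). f i) = (\<Sum>i\<in>UNIV. f (Inl i)) + (\<Sum>i\<in>UNIV. f (Inr i))"
proof -
  have "(\<Sum>i\<in>(UNIV :: ('b + 'c) set). f i) = sum f (UNIV <+> UNIV)"
    by simp
  also have "\<dots> = (\<Sum>i\<in>UNIV. f (Inl i)) + (\<Sum>i\<in>UNIV. f (Inr i))"
    by (subst sum.Plus) (simp_all add: comp_def)
  finally show ?thesis .
qed

lemma inner_vcat: "vcat (a :: real^'b::finite) (b :: real^'c::finite) \<bullet> vcat c d = a \<bullet> c + b \<bullet> d"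
  by (simp add: inner_vec_def sum_UNIV_Plus)

lemma norm_vcat_power2: "norm (vcat (a :: real^'b::finite) (b :: real^'c::finite)) ^ 2 = norm a ^ 2 + norm b ^ 2"
  by (simp add: power2_norm_eq_inner inner_vcat)

lemma norm_vcat_le: "norm (vcat (a :: real^'b::finite) (b :: real^'c::finite)) \<le> norm a + norm b"
  by (rule power2_le_imp_le) (simp_all add: norm_vcat_power2 power2_sum)

lemma norm_le_norm_vcat1: "norm (a :: real^'b::finite) \<le> norm (vcat a (b :: real^'c::finite))"
  and norm_le_norm_vcat2: "norm b \<le> norm (vcat a b)"
  by (rule power2_le_imp_le; simp add: norm_vcat_power2)+

lemma norm_Pair_power2: "norm (a, b) ^ 2 = norm a ^ 2 + norm b ^ 2"
  by (simp add: norm_Pair)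

lemma block2_mult_vcat:
  "block2 M11 M12 M21 M22 *v vcat x y = vcat (M11 *v x + M12 *v y) (M21 *v x + M22 *v y)"
  unfolding vec_eq_iff
proof
  fix i
  show "(block2 M11 M12 M21 M22 *v vcat x y) $ i = vcat (M11 *v x + M12 *v y) (M21 *v x + M22 *v y) $ i"
    by (cases i) (simp_all add: block2_def matrix_vector_mult_def sum_UNIV_Plus)
qed

lemma vstack_mult: "vstack M1 M2 *v x = vcat (M1 *v x) (M2 *v x)"
  unfolding vec_eq_iff
proof
  fix i
  show "(vstack M1 M2 *v x) $ i = vcat (M1 *v x) (M2 *v x) $ i"
    by (cases i) (simp_all add: vstack_def matrix_vector_mult_def)
qed

lemma hstack_mult_vcat: "hstack M1 M2 *v vcat x y = M1 *v x + M2 *v y"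
  by (simp add: hstack_def vec_eq_iff matrix_vector_mult_def sum_UNIV_Plus)

lemma has_integral_vcat:
  fixes f :: "real \<Rightarrow> real^'b::finite" and g :: "real \<Rightarrow> real^'c::finite"
  assumes "(f has_integral a) S" and "(g has_integral b) S"
  shows "((\<lambda>x. vcat (f x) (g x)) has_integral vcat a b) S"
proof -
  have "bounded_linear (\<lambda>v :: real^'b. vcat v (0 :: real^'c))"
    and "bounded_linear (\<lambda>v :: real^'c. vcat (0 :: real^'b) v)"
    by (simp_all add: linear_conv_bounded_linear[symmetric] linearI vcat_add vcat_scaleR)
  from has_integral_add[OF has_integral_linear[OF assms(1) this(1)] has_integral_linear[OF assms(2) this(2)]]
  show ?thesis
    by (simp add: o_def vcat_add)
qed

lemma has_integral_Pair:
  assumes "(f has_integral a) S" and "(g has_integral b) S"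
  shows "((\<lambda>x. (f x, g x)) has_integral (a, b)) S"
proof -
  have "bounded_linear (\<lambda>v. (v, 0 :: 'c))" and "bounded_linear (\<lambda>v. (0 :: 'b, v))"
    by (intro bounded_linear_Pair bounded_linear_ident bounded_linear_zero)+
  from has_integral_add[OF has_integral_linear[OF assms(1) this(1)] has_integral_linear[OF assms(2) this(2)]]
  show ?thesis
    by (simp add: o_def)
qed

section \<open>Quadratic forms\<close>

lemma uminus_matrix_vector_mult: "(- M) *v x = - (M *v (x :: real^'a))"
  by (simp add: vec_eq_iff matrix_vector_mult_def sum_negf)

lemma inner_transpose_mult: "(x :: real^'a) \<bullet> (transpose M *v y) = (M *v x) \<bullet> y"
proof -
  have "x \<bullet> (transpose M *v y) = (y v* M) \<bullet> x"
    by (simp add: inner_commute)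
  also have "\<dots> = y \<bullet> (M *v x)"
    by (rule dot_lmul_matrix)
  finally show ?thesis
    by (simp add: inner_commute)
qed

lemma inner_symmetric_mult: "transpose M = M \<Longrightarrow> (x :: real^'a) \<bullet> (M *v y) = (M *v x) \<bullet> y"
  using inner_transpose_mult[of x M y] by simp

lemma quadratic_form_block2:
  fixes x :: "real^'a" and y :: "real^'b"
  shows "vcat x y \<bullet> (block2 M11 (transpose M21) M21 M22 *v vcat x y)
     = x \<bullet> (M11 *v x) + 2 * (y \<bullet> (M21 *v x)) + y \<bullet> (M22 *v y)"
proof -
  have "x \<bullet> (transpose M21 *v y) = y \<bullet> (M21 *v x)"
    by (simp only: inner_transpose_mult inner_commute)
  then show ?thesis
    by (simp only: block2_mult_vcat inner_vcat inner_add_right)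
qed

lemma norm_matrix_vector_mult_le: "norm (M *v x) \<le> onorm ((*v) M) * norm (x :: real^'a)"
  by (rule onorm[OF matrix_vector_mul_bounded_linear])

lemma norm_matrix_vector_mult_le_bound:
  "norm (x :: real^'a) \<le> b \<Longrightarrow> norm (M *v x) \<le> onorm ((*v) M) * b"
  using norm_matrix_vector_mult_le[of M x] mult_left_mono[of "norm x" b "onorm ((*v) M)"]
    onorm_pos_le[OF matrix_vector_mul_bounded_linear[of M]] by linarith

lemma onorm_matrix_nonneg: "0 \<le> onorm ((*v) (M :: real^'a^'b))"
  by (rule onorm_pos_le[OF matrix_vector_mul_bounded_linear])

lemma quadratic_form_le_onorm: "(x :: real^'a) \<bullet> (M *v x) \<le> onorm ((*v) M) * norm x ^ 2"
proof -
  have "x \<bullet> (M *v x) \<le> norm x * norm (M *v x)"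
    by (rule norm_cauchy_schwarz)
  also have "\<dots> \<le> norm x * (onorm ((*v) M) * norm x)"
    by (intro mult_left_mono norm_matrix_vector_mult_le) simp
  finally show ?thesis
    by (simp add: power2_eq_square mult_ac)
qed

lemma pos_def_symmetric: "pos_def M \<Longrightarrow> transpose M = M"
  by (simp add: pos_def_def)

lemma pos_def_nonneg: "pos_def M \<Longrightarrow> 0 \<le> x \<bullet> (M *v x)"
  unfolding pos_def_def by (cases "x = 0") (auto intro: less_imp_le)

lemma neg_def_nonpos: "neg_def M \<Longrightarrow> x \<bullet> (M *v x) \<le> 0"
  using pos_def_nonneg[of "- M" x] by (simp add: neg_def_def uminus_matrix_vector_mult)

lemma pos_def_coercive:
  fixes M :: "real^'n^'n"
  assumes "pos_def M"
  obtains e where "e > 0" and "\<And>x. e * norm x ^ 2 \<le> x \<bullet> (M *v x)"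
proof -
  let ?Q = "\<lambda>x :: real^'n. x \<bullet> (M *v x)"
  have "continuous_on (sphere 0 1) ?Q"
    by (intro continuous_intros linear_continuous_on matrix_vector_mul_bounded_linear)
  moreover have "sphere (0 :: real^'n) 1 \<noteq> {}"
    using vector_choose_size[of 1] by auto
  ultimately obtain x0 where x0: "x0 \<in> sphere 0 1" and min: "\<And>y. y \<in> sphere 0 1 \<Longrightarrow> ?Q x0 \<le> ?Q y"
    using continuous_attains_inf[OF compact_sphere] by blast
  have "x0 \<noteq> 0"
    using x0 by auto
  then have "?Q x0 > 0"
    using assms by (simp add: pos_def_def)
  moreover have "?Q x0 * norm x ^ 2 \<le> ?Q x" for x
  proof (cases "x = 0")
    case False
    have "?Q x0 \<le> ?Q ((1 / norm x) *\<^sub>R x)"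
      using False by (intro min) simp
    also have "\<dots> = ?Q x / norm x ^ 2"
      by (simp add: matrix_vector_mult_scaleR power2_eq_square)
    finally show ?thesis
      using False by (simp add: field_simps)
  qed simp
  ultimately show ?thesis
    using that by blast
qed

lemma neg_def_coercive:
  fixes M :: "real^'n^'n"
  assumes "neg_def M"
  obtains e where "e > 0" and "\<And>x. x \<bullet> (M *v x) \<le> - e * norm x ^ 2"
proof -
  obtain e where "e > 0" and "\<And>x. e * norm x ^ 2 \<le> x \<bullet> ((- M) *v x)"
    using assms pos_def_coercive unfolding neg_def_def by blast
  then show ?thesis
    using that by (simp add: uminus_matrix_vector_mult le_minus_iff)
qed

lemma young_inner:
  fixes u v :: "'a::real_inner"
  assumes "t > 0"
  shows "2 * (u \<bullet> v) \<le> t * norm u ^ 2 + norm v ^ 2 / t"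
proof -
  have "0 \<le> norm (t *\<^sub>R u - v) ^ 2"
    by simp
  also have "\<dots> = t\<^sup>2 * norm u ^ 2 - 2 * t * (u \<bullet> v) + norm v ^ 2"
    by (simp only: power2_norm_eq_inner)
      (simp add: inner_commute algebra_simps power2_eq_square)
  finally show ?thesis
    using assms by (simp add: field_simps power2_eq_square)
qed

lemma matrix_inv_unique:
  fixes A :: "real^'n^'n"
  assumes "A ** A' = mat 1" and "A' ** A = mat 1"
  shows "matrix_inv A = A'"
  unfolding matrix_inv_def
proof (rule some_equality)
  fix X
  assume "A ** X = mat 1 \<and> X ** A = mat 1"
  then have "A' ** (A ** X) = A'"
    by simp
  then show "X = A'"
    by (simp add: matrix_mul_assoc assms)
qed (use assms in simp)

lemma matrix_mul_matrix_inv: "invertible (M :: real^'n^'n) \<Longrightarrow> M ** matrix_inv M = mat 1"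
  unfolding invertible_def matrix_inv_def by (rule someI2_ex) auto

section \<open>The LMIs as scalar inequalities\<close>

lemma G0_mult_vcat: "G0 *v vcat x y = x"
  by (simp add: G0_def hstack_mult_vcat)

lemma Kmat_mult_vcat: "Kmat K1 K2 *v vcat x y = K1 *v x + K2 *v y"
  by (simp add: Kmat_def hstack_mult_vcat)

lemma AK_mult_vcat: "AK B K1 K2 *v vcat x y = vcat (B *v (K1 *v x + K2 *v y)) x"
  by (simp add: AK_def A0_def B0_def matrix_vector_mult_add_rdistrib Kmat_mult_vcat
      block2_mult_vcat vstack_mult vcat_add flip: matrix_vector_mul_assoc)

lemma Zd_mult_vcat:
  "Zd mu beta piz kappa *v vcat (vcat w1 w2) (vcat w3 w4)
     = vcat (vcat (mu *\<^sub>R w1) (beta *\<^sub>R w2)) (vcat (piz *\<^sub>R w3) (kappa *\<^sub>R w4))"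
  by (simp add: Zd_def block2_mult_vcat flip: scaleR_matrix_vector_assoc)

lemma quadratic_form_Zd:
  "vcat (vcat w1 w2) (vcat w3 w4) \<bullet> (Zd mu beta piz kappa *v vcat (vcat w1 w2) (vcat w3 w4))
     = mu * norm w1 ^ 2 + beta * norm w2 ^ 2 + piz * norm w3 ^ 2 + kappa * norm w4 ^ 2"
  by (simp add: Zd_mult_vcat inner_vcat power2_norm_eq_inner)

lemma Zd_mult_Zd_inverse:
  assumes "mu \<noteq> 0" "beta \<noteq> 0" "piz \<noteq> 0" "kappa \<noteq> 0"
  shows "Zd mu beta piz kappa ** Zd (1/mu) (1/beta) (1/piz) (1/kappa)
           = (mat 1 :: real^(('n::finite + 'n) + ('n + 'n))^(('n + 'n) + ('n + 'n)))"
  unfolding matrix_eq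
proof
  fix x :: "real^(('n::finite + 'n) + ('n + 'n))"
  obtain u v where x: "x = vcat u v"
    by (rule vcat_cases)
  obtain w1 w2 w3 w4 where "u = vcat w1 w2" and "v = vcat w3 w4"
    by (metis vcat_cases)
  then show "(Zd mu beta piz kappa ** Zd (1/mu) (1/beta) (1/piz) (1/kappa)) *v x = mat 1 *v x"
    using assms by (simp add: x Zd_mult_vcat flip: matrix_vector_mul_assoc)
qed

lemma matrix_inv_Zd:
  assumes "mu \<noteq> 0" "beta \<noteq> 0" "piz \<noteq> 0" "kappa \<noteq> 0"
  shows "matrix_inv (Zd mu beta piz kappa :: real^(('n::finite + 'n) + ('n + 'n))^(('n + 'n) + ('n + 'n)))
           = Zd (1/mu) (1/beta) (1/piz) (1/kappa)"
  using Zd_mult_Zd_inverse[of mu beta piz kappa] Zd_mult_Zd_inverse[of "1/mu" "1/beta" "1/piz" "1/kappa"] assms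
  by (intro matrix_inv_unique) simp_all

lemma pos_def_Zd_imp_pos:
  assumes "pos_def (Zd mu beta piz kappa :: real^(('n::finite + 'n) + ('n + 'n))^(('n + 'n) + ('n + 'n)))"
  shows "mu > 0" and "beta > 0" and "piz > 0" and "kappa > 0"
proof -
  obtain e :: "real^'n" where e: "norm e = 1"
    using vector_choose_size[of 1] by auto
  then have "e \<noteq> 0"
    by auto
  have "0 < w \<bullet> (Zd mu beta piz kappa *v w)" if "w \<noteq> 0" for w :: "real^(('n + 'n) + ('n + 'n))"
    using assms that unfolding pos_def_def by blast
  from this[of "vcat (vcat e 0) (vcat 0 0)"] this[of "vcat (vcat 0 e) (vcat 0 0)"]
    this[of "vcat (vcat 0 0) (vcat e 0)"] this[of "vcat (vcat 0 0) (vcat 0 e)"]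
  show "mu > 0" and "beta > 0" and "piz > 0" and "kappa > 0"
    using \<open>e \<noteq> 0\<close> e by (simp_all add: quadratic_form_Zd vcat_eq_0_iff)
qed

lemma LMI1_quadratic:
  fixes A S :: "real^'r^'r" and E :: "real^'n^'r" and P :: "real^('n + 'n)^('n + 'n)"
  assumes LMI1: "neg_def (block2
                 (transpose A ** S + S ** A + rho *\<^sub>R S)
                 (transpose ((1/alpha) *\<^sub>R (transpose G0 ** transpose E ** S)))
                 ((1/alpha) *\<^sub>R (transpose G0 ** transpose E ** S))
                 (- (rho *\<^sub>R P)))"
    and "transpose S = S"
  obtains e where "e > 0"
    and "\<And>z \<xi>. 2 * ((A *v z) \<bullet> (S *v z)) + rho * (z \<bullet> (S *v z))
              + (2/alpha) * ((E *v (G0 *v \<xi>)) \<bullet> (S *v z)) - rho * (\<xi> \<bullet> (P *v \<xi>))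
            \<le> - e * (norm z ^ 2 + norm \<xi> ^ 2)"
proof -
  obtain e where "e > 0" and e: "\<And>x. x \<bullet> ((block2
                 (transpose A ** S + S ** A + rho *\<^sub>R S)
                 (transpose ((1/alpha) *\<^sub>R (transpose G0 ** transpose E ** S)))
                 ((1/alpha) *\<^sub>R (transpose G0 ** transpose E ** S))
                 (- (rho *\<^sub>R P))) *v x) \<le> - e * norm x ^ 2"
    using neg_def_coercive[OF LMI1] by blast
  have "2 * ((A *v z) \<bullet> (S *v z)) + rho * (z \<bullet> (S *v z))
          + (2/alpha) * ((E *v (G0 *v \<xi>)) \<bullet> (S *v z)) - rho * (\<xi> \<bullet> (P *v \<xi>))
        \<le> - e * (norm z ^ 2 + norm \<xi> ^ 2)" for z \<xi>
  proof -
    have "z \<bullet> ((transpose A ** S) *v z) = (A *v z) \<bullet> (S *v z)"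
      by (simp only: inner_transpose_mult flip: matrix_vector_mul_assoc)
    moreover have "z \<bullet> ((S ** A) *v z) = (A *v z) \<bullet> (S *v z)"
      using inner_symmetric_mult[OF \<open>transpose S = S\<close>, of z "A *v z"]
      by (simp add: inner_commute flip: matrix_vector_mul_assoc)
    ultimately have "z \<bullet> ((transpose A ** S + S ** A + rho *\<^sub>R S) *v z)
        = 2 * ((A *v z) \<bullet> (S *v z)) + rho * (z \<bullet> (S *v z))"
      by (simp add: matrix_vector_mult_add_rdistrib inner_add_right flip: scaleR_matrix_vector_assoc)
    moreover have "\<xi> \<bullet> ((transpose G0 ** transpose E ** S) *v z) = (E *v (G0 *v \<xi>)) \<bullet> (S *v z)"
      by (simp only: inner_transpose_mult flip: matrix_vector_mul_assoc)
    then have "\<xi> \<bullet> (((1/alpha) *\<^sub>R (transpose G0 ** transpose E ** S)) *v z)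
        = (1/alpha) * ((E *v (G0 *v \<xi>)) \<bullet> (S *v z))"
      by (simp flip: scaleR_matrix_vector_assoc)
    moreover have "\<xi> \<bullet> ((- (rho *\<^sub>R P)) *v \<xi>) = - rho * (\<xi> \<bullet> (P *v \<xi>))"
      by (simp add: uminus_matrix_vector_mult flip: scaleR_matrix_vector_assoc)
    ultimately show ?thesis
      using e[of "vcat z \<xi>"] by (simp add: quadratic_form_block2 norm_vcat_power2)
  qed
  with \<open>e > 0\<close> show ?thesis
    by (rule that)
qed

lemma quadratic_form_Mstack_Zd:
  assumes "transpose P = P"
  shows "x \<bullet> ((P ** transpose Mstack ** Zd mu beta piz kappa ** Mstack ** P) *v x)
     = mu * norm (transpose E0 *v (P *v x)) ^ 2 + beta * norm (transpose F0 *v (P *v x)) ^ 2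
       + (piz + kappa) * norm (G0 *v (P *v x)) ^ 2"
proof -
  let ?p = "P *v x"
  have "x \<bullet> ((P ** transpose Mstack ** Zd mu beta piz kappa ** Mstack ** P) *v x)
      = ?p \<bullet> (transpose Mstack *v (Zd mu beta piz kappa *v (Mstack *v ?p)))"
    by (simp only: inner_symmetric_mult[OF assms] flip: matrix_vector_mul_assoc)
  also have "\<dots> = (Mstack *v ?p) \<bullet> (Zd mu beta piz kappa *v (Mstack *v ?p))"
    by (rule inner_transpose_mult)
  finally show ?thesis
    by (simp add: Mstack_def vstack_mult quadratic_form_Zd algebra_simps)
qed

lemma quadratic_form_Nstack_Zd_inverse:
  assumes "mu \<noteq> 0" "beta \<noteq> 0" "piz \<noteq> 0" "kappa \<noteq> 0"
  shows "vcat a b \<bullet> ((transpose (Nstack B K1 K2 D gamma alpha) ** matrix_inv (Zd mu beta piz kappa)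
              ** Nstack B K1 K2 D gamma alpha) *v vcat a b)
     = norm (B *v (K1 *v a + K2 *v b)) ^ 2 / mu + norm a ^ 2 / (beta * gamma\<^sup>2)
       + norm (D *v a) ^ 2 / (piz * alpha\<^sup>2)"
proof -
  let ?N = "Nstack B K1 K2 D gamma alpha"
  have "vcat a b \<bullet> ((transpose ?N ** matrix_inv (Zd mu beta piz kappa) ** ?N) *v vcat a b)
      = (?N *v vcat a b) \<bullet> (Zd (1/mu) (1/beta) (1/piz) (1/kappa) *v (?N *v vcat a b))"
    by (simp only: inner_transpose_mult matrix_inv_Zd[OF assms] flip: matrix_vector_mul_assoc)
  also have "?N *v vcat a b
      = vcat (vcat (B *v (K1 *v a + K2 *v b)) ((1/gamma) *\<^sub>R a)) (vcat ((1/alpha) *\<^sub>R (D *v a)) 0)"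
    by (simp add: Nstack_def vstack_mult Kmat_mult_vcat G0_mult_vcat
        flip: matrix_vector_mul_assoc scaleR_matrix_vector_assoc)
  finally show ?thesis
    by (simp add: quadratic_form_Zd field_simps)
qed

lemma LMI2_quadratic:
  fixes P :: "real^('n::finite + 'n)^('n + 'n)"
  assumes LMI2: "neg_def (transpose (AK B K1 K2) ** P + P ** AK B K1 K2
                 + P ** transpose Mstack ** Zd mu beta piz kappa ** Mstack ** P
                 + transpose (Nstack B K1 K2 D gamma alpha) ** matrix_inv (Zd mu beta piz kappa)
                     ** Nstack B K1 K2 D gamma alpha
                 + rho *\<^sub>R P)"
    and "transpose P = P" and "mu > 0" "beta > 0" "piz > 0" "kappa > 0"
  shows "2 * ((AK B K1 K2 *v \<xi>) \<bullet> (P *v \<xi>)) + (piz + kappa) * norm (G0 *v (P *v \<xi>)) ^ 2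
          + norm (D *v (G0 *v \<xi>)) ^ 2 / (piz * alpha\<^sup>2) + rho * (\<xi> \<bullet> (P *v \<xi>)) \<le> 0"
proof -
  obtain a b where \<xi>: "\<xi> = vcat a b"
    by (rule vcat_cases)
  have "\<xi> \<bullet> ((transpose (AK B K1 K2) ** P) *v \<xi>) = (AK B K1 K2 *v \<xi>) \<bullet> (P *v \<xi>)"
    by (simp only: inner_transpose_mult flip: matrix_vector_mul_assoc)
  moreover have "\<xi> \<bullet> ((P ** AK B K1 K2) *v \<xi>) = (AK B K1 K2 *v \<xi>) \<bullet> (P *v \<xi>)"
    using inner_symmetric_mult[OF \<open>transpose P = P\<close>, of \<xi> "AK B K1 K2 *v \<xi>"]
    by (simp add: inner_commute flip: matrix_vector_mul_assoc)
  moreover have "\<xi> \<bullet> ((rho *\<^sub>R P) *v \<xi>) = rho * (\<xi> \<bullet> (P *v \<xi>))"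
    by (simp flip: scaleR_matrix_vector_assoc)
  moreover note quadratic_form_Mstack_Zd[OF \<open>transpose P = P\<close>, of \<xi> mu beta piz kappa]
    quadratic_form_Nstack_Zd_inverse[of mu beta piz kappa a b B K1 K2 D gamma alpha]
  ultimately have "2 * ((AK B K1 K2 *v \<xi>) \<bullet> (P *v \<xi>))
      + (mu * norm (transpose E0 *v (P *v \<xi>)) ^ 2 + beta * norm (transpose F0 *v (P *v \<xi>)) ^ 2
         + (piz + kappa) * norm (G0 *v (P *v \<xi>)) ^ 2)
      + (norm (B *v (K1 *v a + K2 *v b)) ^ 2 / mu + norm a ^ 2 / (beta * gamma\<^sup>2)
         + norm (D *v a) ^ 2 / (piz * alpha\<^sup>2))
      + rho * (\<xi> \<bullet> (P *v \<xi>)) \<le> 0"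
    using neg_def_nonpos[OF LMI2, of \<xi>] assms(3-6)
    by (simp add: matrix_vector_mult_add_rdistrib inner_add_right \<xi>)
  moreover have "G0 *v \<xi> = a"
    by (simp add: \<xi> G0_mult_vcat)
  ultimately show ?thesis
    using assms(3,4) by (smt (verit) divide_nonneg_nonneg mult_nonneg_nonneg zero_le_power2)
qed

lemma LMI3_quadratic:
  fixes S :: "real^'r^'r" and C0m :: "real^'r^'n"
  assumes LMI3: "pos_def (block2 (rho *\<^sub>R S) (transpose C0m) C0m (kappa *\<^sub>R mat 1))"
    and "kappa > 0"
  shows "norm (C0m *v z) ^ 2 / kappa \<le> rho * (z \<bullet> (S *v z))"
proof -
  let ?w = "- (1/kappa) *\<^sub>R (C0m *v z)"
  have "0 \<le> vcat z ?w \<bullet> (block2 (rho *\<^sub>R S) (transpose C0m) C0m (kappa *\<^sub>R mat 1) *v vcat z ?w)"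
    by (rule pos_def_nonneg[OF LMI3])
  also have "\<dots> = rho * (z \<bullet> (S *v z)) + 2 * (?w \<bullet> (C0m *v z)) + kappa * (?w \<bullet> ?w)"
    by (simp add: quadratic_form_block2 flip: scaleR_matrix_vector_assoc)
  also have "\<dots> = rho * (z \<bullet> (S *v z)) - norm (C0m *v z) ^ 2 / kappa"
    using \<open>kappa > 0\<close> by (simp add: dot_square_norm power2_eq_square field_simps)
  finally show ?thesis
    by simp
qed

section \<open>Reaching a sublevel set of a quadratic Lyapunov function\<close>

lemma le_by_uniform_steps:
  fixes g :: "real \<Rightarrow> real"
  assumes "h > 0" and "0 \<le> T"
    and step: "\<And>s t. 0 \<le> s \<Longrightarrow> s \<le> t \<Longrightarrow> t \<le> T \<Longrightarrow> t - s \<le> h \<Longrightarrow> g t \<le> g s"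
  shows "g T \<le> g 0"
proof -
  define n :: nat where "n = nat \<lceil>T / h\<rceil> + 1"
  define d where "d = T / n"
  have "n > 0" and "0 \<le> d"
    using \<open>0 \<le> T\<close> by (simp_all add: n_def d_def)
  have "T / h \<le> n"
    unfolding n_def by linarith
  then have "d \<le> h"
    using \<open>h > 0\<close> \<open>n > 0\<close> by (simp add: d_def field_simps)
  have "g (real k * d) \<le> g 0" if "k \<le> n" for k
    using that
  proof (induction k)
    case (Suc k)
    have "real (Suc k) * d \<le> real n * d"
      using Suc.prems \<open>0 \<le> d\<close> by (intro mult_right_mono) auto
    also have "\<dots> = T"
      using \<open>n > 0\<close> by (simp add: d_def)
    finally have "g (real k * d + d) \<le> g (real k * d)"
      using \<open>0 \<le> d\<close> \<open>d \<le> h\<close> by (intro step) (auto simp: algebra_simps)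
    with Suc show ?case
      by (simp add: algebra_simps)
  qed simp
  from this[of n] show ?thesis
    using \<open>n > 0\<close> by (simp add: d_def)
qed

lemma has_integral_increment:
  fixes Y dY :: "real \<Rightarrow> 'a::banach"
  assumes Y: "\<And>t. 0 \<le> t \<Longrightarrow> (dY has_integral (Y t - Y 0)) {0..t}" and "0 \<le> s" and "s \<le> t"
  shows "(dY has_integral (Y t - Y s)) {s..t}"
proof -
  have "0 \<le> t"
    using assms(2,3) by linarith
  have "dY integrable_on {s..t}"
    using assms(2,3) by (intro integrable_subinterval_real[OF has_integral_integrable[OF Y[OF \<open>0 \<le> t\<close>]]]) auto
  then obtain i where i: "(dY has_integral i) {s..t}"
    by blast
  have "(dY has_integral (Y s - Y 0) + i) {0..t}"
    using has_integral_combine[OF \<open>0 \<le> s\<close> \<open>s \<le> t\<close> Y[OF \<open>0 \<le> s\<close>] i] .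
  then have "Y t - Y 0 = (Y s - Y 0) + i"
    by (rule has_integral_unique[OF Y[OF \<open>0 \<le> t\<close>]])
  with i show ?thesis
    by (simp add: algebra_simps)
qed

lemma has_integral_norm_increment_le:
  fixes Y dY :: "real \<Rightarrow> 'a::real_normed_vector"
  assumes "(dY has_integral (Y t - Y s)) {s..t}" and "s \<le> t" and "negligible N" and "0 \<le> M"
    and "\<And>u. u \<in> {s..t} - N \<Longrightarrow> norm (dY u) \<le> M"
  shows "norm (Y t - Y s) \<le> M * (t - s)"
proof -
  have "((\<lambda>u. if u \<in> N then 0 else dY u) has_integral (Y t - Y s)) {s..t}"
    by (rule has_integral_spike[OF \<open>negligible N\<close> _ assms(1)]) simp
  from has_integral_bound_real[OF \<open>0 \<le> M\<close> finite.emptyI this] assms(2,4,5)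
  show ?thesis
    by simp
qed

lemma inner_bounded_linear_le:
  fixes q :: "'a::real_inner \<Rightarrow> 'a"
  assumes "\<And>x. norm (q x) \<le> norm x * K" and "0 \<le> K" and "norm u \<le> M" and "norm w \<le> r"
  shows "\<bar>u \<bullet> q w\<bar> \<le> M * (K * r)"
proof -
  have "norm (q w) \<le> K * r"
    using assms(1)[of w] mult_right_mono[OF assms(4) assms(2)] by (simp add: mult.commute)
  then have "norm u * norm (q w) \<le> M * (K * r)"
    using assms(3) order_trans[OF norm_ge_zero assms(3)] by (intro mult_mono) auto
  then show ?thesis
    using Cauchy_Schwarz_ineq2[of u "q w"] by linarith
qed

text \<open>Over a short interval the increment of the form \<open>L = Y \<bullet> q Y\<close> is the integral of
  \<open>dY \<bullet> q (Y t + Y s)\<close>, which differs from the derivative \<open>2 (dY \<bullet> q Y)\<close> of \<open>L\<close> by at most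
  \<open>M\<^sup>2 K (t - s)\<close> thanks to the Lipschitz bound on \<open>Y\<close>; no chain rule for absolutely
  continuous functions is needed.\<close>

lemma quadratic_form_decrease_step:
  fixes Y dY :: "real \<Rightarrow> 'a::euclidean_space" and q :: "'a \<Rightarrow> 'a"
  assumes "linear q" and q_sym: "\<And>x y. x \<bullet> q y = y \<bullet> q x" and q_bound: "\<And>x. norm (q x) \<le> norm x * K"
    and Y: "(dY has_integral (Y t - Y s)) {s..t}" and "s \<le> t" and "negligible N"
    and lipschitz: "\<And>u v. u \<in> {s..t} \<Longrightarrow> v \<in> {s..t} \<Longrightarrow> norm (Y u - Y v) \<le> M * \<bar>u - v\<bar>"
    and dY_bound: "\<And>u. u \<in> {s..t} - N \<Longrightarrow> norm (dY u) \<le> M"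
    and decrease: "\<And>u. u \<in> {s..t} - N \<Longrightarrow> 2 * (dY u \<bullet> q (Y u)) \<le> -1"
    and short: "M * M * K * (t - s) \<le> 1/2" and "0 \<le> M" and "0 \<le> K"
  shows "Y t \<bullet> q (Y t) \<le> Y s \<bullet> q (Y s) - (t - s) / 2"
proof -
  define v where "v = q (Y t + Y s)"
  have "Y t \<bullet> q (Y t) - Y s \<bullet> q (Y s) = (Y t - Y s) \<bullet> v"
    using q_sym[of "Y t" "Y s"]
    by (simp add: v_def linear_add[OF \<open>linear q\<close>] inner_diff_left inner_add_right)
  moreover have "((\<lambda>u. dY u \<bullet> v) has_integral (Y t - Y s) \<bullet> v) {s..t}"
    using has_integral_linear[OF Y bounded_linear_inner_left[of v]] by (simp add: o_def)
  then have spiked: "((\<lambda>u. if u \<in> N then -1/2 else dY u \<bullet> v) has_integral (Y t - Y s) \<bullet> v) {s..t}"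
    by (rule has_integral_spike[OF \<open>negligible N\<close>, rotated]) simp
  moreover have "dY u \<bullet> v \<le> -1/2" if u: "u \<in> {s..t} - N" for u
  proof -
    have near: "\<bar>dY u \<bullet> q (Y w - Y u)\<bar> \<le> M * (K * (M * \<bar>w - u\<bar>))" if "w \<in> {s..t}" for w
      using inner_bounded_linear_le[OF q_bound \<open>0 \<le> K\<close> dY_bound[OF u] lipschitz[OF that DiffD1[OF u]]] .
    have "dY u \<bullet> v = 2 * (dY u \<bullet> q (Y u)) + dY u \<bullet> q (Y t - Y u) + dY u \<bullet> q (Y s - Y u)"
      by (simp add: v_def linear_add[OF \<open>linear q\<close>] linear_diff[OF \<open>linear q\<close>]
          inner_add_right inner_diff_right)
    also have "\<dots> \<le> -1 + (M * (K * (M * (t - u))) + M * (K * (M * (u - s))))"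
      using decrease[OF u] near[of t] near[of s] u by (auto simp: abs_le_iff)
    also have "\<dots> = -1 + M * M * K * (t - s)"
      by (simp add: algebra_simps)
    finally show ?thesis
      using short by linarith
  qed
  moreover have "((\<lambda>u. -1/2) has_integral (t - s) * (-1/2)) {s..t}"
    using has_integral_const_real[of "-1/2 :: real" s t] \<open>s \<le> t\<close> by simp
  ultimately have "Y t \<bullet> q (Y t) - Y s \<bullet> q (Y s) \<le> (t - s) * (-1/2)"
    using has_integral_le[OF spiked] by auto
  then show ?thesis
    by simp
qed

lemma integral_form_lipschitz:
  fixes Y dY :: "real \<Rightarrow> 'a::euclidean_space"
  assumes Y: "\<And>t. 0 \<le> t \<Longrightarrow> (dY has_integral (Y t - Y 0)) {0..t}" and "negligible N" and "0 \<le> T"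
    and growth: "\<And>t. 0 \<le> t \<Longrightarrow> t \<notin> N \<Longrightarrow> norm (dY t) \<le> a + b * norm (Y t)"
  obtains M where "0 \<le> M" and "\<And>u. u \<in> {0..T} - N \<Longrightarrow> norm (dY u) \<le> M"
    and "\<And>u v. u \<in> {0..T} \<Longrightarrow> v \<in> {0..T} \<Longrightarrow> norm (Y u - Y v) \<le> M * \<bar>u - v\<bar>"
proof -
  have "continuous_on {0..T} (\<lambda>t. Y 0 + integral {0..t} dY)"
    using Y[of T] \<open>0 \<le> T\<close>
    by (intro continuous_intros indefinite_integral_continuous_1 has_integral_integrable) auto
  moreover have "Y 0 + integral {0..t} dY = Y t" if "t \<in> {0..T}" for t
    using Y[of t] that by (simp add: integral_unique)
  ultimately have "continuous_on {0..T} Y"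
    by (rule continuous_on_eq)
  then have "bounded (Y ` {0..T})"
    by (intro compact_imp_bounded compact_continuous_image compact_Icc)
  then obtain B where "\<forall>y\<in>Y ` {0..T}. norm y \<le> B"
    by (auto simp: bounded_iff)
  then have B: "norm (Y t) \<le> B" if "t \<in> {0..T}" for t
    using that by blast
  define M where "M = \<bar>a\<bar> + \<bar>b\<bar> * \<bar>B\<bar>"
  have "0 \<le> M"
    by (simp add: M_def)
  have dY_bound: "norm (dY u) \<le> M" if "u \<in> {0..T} - N" for u
  proof -
    have "b * norm (Y u) \<le> \<bar>b\<bar> * norm (Y u)"
      by (simp add: mult_right_mono)
    also have "\<dots> \<le> \<bar>b\<bar> * \<bar>B\<bar>"
      using B[of u] that by (intro mult_left_mono) auto
    finally show ?thesis
      using growth[of u] that by (auto simp: M_def)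
  qed
  have increment_bound: "norm (Y t - Y s) \<le> M * (t - s)" if "s \<in> {0..T}" "t \<in> {0..T}" "s \<le> t" for s t
    by (rule has_integral_norm_increment_le[OF has_integral_increment[OF Y] \<open>s \<le> t\<close> \<open>negligible N\<close> \<open>0 \<le> M\<close>])
      (use that dY_bound in auto)
  have "norm (Y u - Y v) \<le> M * \<bar>u - v\<bar>" if "u \<in> {0..T}" "v \<in> {0..T}" for u v
    using increment_bound[of v u] increment_bound[of u v] that by (cases "v \<le> u") (auto simp: norm_minus_commute)
  with \<open>0 \<le> M\<close> dY_bound show ?thesis
    using that by blast
qed

lemma reaches_sublevel_set:
  fixes Y dY :: "real \<Rightarrow> 'a::euclidean_space" and q :: "'a \<Rightarrow> 'a"
  assumes "bounded_linear q" and q_sym: "\<And>x y. x \<bullet> q y = y \<bullet> q x" and q_nonneg: "\<And>x. 0 \<le> x \<bullet> q x"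
    and Y: "\<And>t. 0 \<le> t \<Longrightarrow> (dY has_integral (Y t - Y 0)) {0..t}" and "negligible N"
    and growth: "\<And>t. 0 \<le> t \<Longrightarrow> t \<notin> N \<Longrightarrow> norm (dY t) \<le> a + b * norm (Y t)"
    and decrease: "\<And>t. 0 \<le> t \<Longrightarrow> t \<notin> N \<Longrightarrow> c < Y t \<bullet> q (Y t) \<Longrightarrow> 2 * (dY t \<bullet> q (Y t)) \<le> -1"
  shows "\<exists>t\<ge>0. Y t \<bullet> q (Y t) \<le> c"
proof (rule ccontr)
  assume "\<not> ?thesis"
  then have above: "c < Y t \<bullet> q (Y t)" if "0 \<le> t" for t
    using that by force
  define L where "L t = Y t \<bullet> q (Y t)" for t
  define T where "T = 2 * L 0 + 1"
  have "0 \<le> T"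
    using q_nonneg[of "Y 0"] by (simp add: T_def L_def)
  obtain M where "0 \<le> M" and dY_bound: "\<And>u. u \<in> {0..T} - N \<Longrightarrow> norm (dY u) \<le> M"
    and lipschitz: "\<And>u v. u \<in> {0..T} \<Longrightarrow> v \<in> {0..T} \<Longrightarrow> norm (Y u - Y v) \<le> M * \<bar>u - v\<bar>"
    using integral_form_lipschitz[OF Y \<open>negligible N\<close> \<open>0 \<le> T\<close> growth] by blast
  obtain K where "0 \<le> K" and K: "\<And>x. norm (q x) \<le> norm x * K"
    using bounded_linear.nonneg_bounded[OF \<open>bounded_linear q\<close>] by blast
  have "0 \<le> M * M * K"
    using \<open>0 \<le> M\<close> \<open>0 \<le> K\<close> by simp
  define h where "h = 1 / (2 * (M * M * K) + 1)"
  have "0 < h" and "M * M * K * h \<le> 1/2"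
    using \<open>0 \<le> M * M * K\<close> by (simp_all add: h_def field_simps)
  have "L t + t / 2 \<le> L s + s / 2" if "0 \<le> s" "s \<le> t" "t \<le> T" "t - s \<le> h" for s t
  proof -
    have "M * M * K * (t - s) \<le> M * M * K * h"
      using that \<open>0 \<le> M\<close> \<open>0 \<le> K\<close> by (intro mult_left_mono) auto
    have "L t \<le> L s - (t - s) / 2"
      unfolding L_def
    proof (rule quadratic_form_decrease_step[OF bounded_linear.linear[OF \<open>bounded_linear q\<close>] q_sym K
          has_integral_increment[OF Y \<open>0 \<le> s\<close> \<open>s \<le> t\<close>] \<open>s \<le> t\<close> \<open>negligible N\<close> _ _ _ _ \<open>0 \<le> M\<close> \<open>0 \<le> K\<close>])
      show "norm (Y u - Y v) \<le> M * \<bar>u - v\<bar>" if "u \<in> {s..t}" "v \<in> {s..t}" for u v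
        using lipschitz \<open>0 \<le> s\<close> \<open>t \<le> T\<close> that by auto
      show "norm (dY u) \<le> M" if "u \<in> {s..t} - N" for u
        using dY_bound \<open>0 \<le> s\<close> \<open>t \<le> T\<close> that by auto
      show "2 * (dY u \<bullet> q (Y u)) \<le> -1" if "u \<in> {s..t} - N" for u
        using decrease above \<open>0 \<le> s\<close> that by auto
      show "M * M * K * (t - s) \<le> 1/2"
        using \<open>M * M * K * (t - s) \<le> M * M * K * h\<close> \<open>M * M * K * h \<le> 1/2\<close> by linarith
    qed
    then show ?thesis
      by (simp add: field_simps)
  qed
  from le_by_uniform_steps[of h T "\<lambda>t. L t + t / 2", OF \<open>0 < h\<close> \<open>0 \<le> T\<close> this]
  have "L T + T / 2 \<le> L 0"
    by simp
  moreover have "0 \<le> L T"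
    by (simp add: L_def q_nonneg)
  ultimately show False
    using T_def by (simp add: field_simps)
qed

lemma power2_dominates_sqrt_growth:
  fixes e a b :: real
  assumes "0 < e" and "0 \<le> a" and "0 \<le> b"
  obtains R where "1 \<le> R" and "\<And>n. R \<le> n \<Longrightarrow> a * n + b * n * sqrt n + 1 \<le> e * n\<^sup>2"
proof
  define R where "R = max 1 (((a + b + 1) / e)\<^sup>2)"
  show "1 \<le> R"
    by (simp add: R_def)
  fix n :: real
  assume "R \<le> n"
  then have "1 \<le> n"
    by (simp add: R_def)
  have "(a + b + 1) / e \<le> sqrt n"
    using \<open>R \<le> n\<close> assms by (intro real_le_rsqrt) (simp add: R_def)
  then have "a + b + 1 \<le> e * sqrt n"
    using \<open>0 < e\<close> by (simp add: field_simps)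
  then have "(a + b + 1) * (n * sqrt n) \<le> e * sqrt n * (n * sqrt n)"
    using \<open>1 \<le> n\<close> by (intro mult_right_mono) auto
  also have "\<dots> = e * n\<^sup>2"
    using \<open>1 \<le> n\<close> by (simp add: power2_eq_square algebra_simps)
  finally have "(a + b + 1) * (n * sqrt n) \<le> e * n\<^sup>2" .
  moreover have "n \<le> n * sqrt n"
    using \<open>1 \<le> n\<close> by (simp add: mult_le_cancel_left1)
  moreover from this have "1 \<le> n * sqrt n"
    using \<open>1 \<le> n\<close> by linarith
  ultimately show "a * n + b * n * sqrt n + 1 \<le> e * n\<^sup>2"
    using \<open>0 \<le> a\<close> mult_left_mono[OF \<open>n \<le> n * sqrt n\<close> \<open>0 \<le> a\<close>] by (simp add: algebra_simps)
qed

lemma quadratic_lyapunov_reaching: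
  fixes q :: "'a::euclidean_space \<Rightarrow> 'a"
  assumes "bounded_linear q" and q_sym: "\<And>x y. x \<bullet> q y = y \<bullet> q x" and q_nonneg: "\<And>x. 0 \<le> x \<bullet> q x"
    and "0 < e" and "0 \<le> a" and "0 \<le> b"
  obtains c where "0 < c"
    and "\<And>(Y :: real \<Rightarrow> 'a) dY N. (\<And>t. 0 \<le> t \<Longrightarrow> (dY has_integral (Y t - Y 0)) {0..t}) \<Longrightarrow> negligible N
      \<Longrightarrow> (\<And>t. 0 \<le> t \<Longrightarrow> t \<notin> N \<Longrightarrow> norm (dY t) \<le> a + b * norm (Y t))
      \<Longrightarrow> (\<And>t. 0 \<le> t \<Longrightarrow> t \<notin> N \<Longrightarrow> 2 * (dY t \<bullet> q (Y t))
              \<le> - e * norm (Y t) ^ 2 + a * norm (Y t) + b * norm (Y t) * sqrt (norm (Y t)))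
      \<Longrightarrow> \<exists>t\<ge>0. Y t \<bullet> q (Y t) \<le> c"
proof -
  obtain K where "0 \<le> K" and K: "\<And>x. norm (q x) \<le> norm x * K"
    using bounded_linear.nonneg_bounded[OF \<open>bounded_linear q\<close>] by blast
  have form_le: "y \<bullet> q y \<le> K * norm y ^ 2" for y
    using norm_cauchy_schwarz[of y "q y"] mult_left_mono[OF K[of y] norm_ge_zero[of y]]
    by (simp add: power2_eq_square mult_ac)
  obtain R where "1 \<le> R" and R: "\<And>n. R \<le> n \<Longrightarrow> a * n + b * n * sqrt n + 1 \<le> e * n\<^sup>2"
    using power2_dominates_sqrt_growth[OF \<open>0 < e\<close> \<open>0 \<le> a\<close> \<open>0 \<le> b\<close>] by blast
  define c where "c = K * R\<^sup>2 + 1"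
  show ?thesis
  proof (rule that[of c])
    show "0 < c"
      using \<open>0 \<le> K\<close> by (simp add: c_def add_nonneg_pos)
    fix Y dY :: "real \<Rightarrow> 'a" and N
    assume Y: "\<And>t. 0 \<le> t \<Longrightarrow> (dY has_integral (Y t - Y 0)) {0..t}" and "negligible N"
      and growth: "\<And>t. 0 \<le> t \<Longrightarrow> t \<notin> N \<Longrightarrow> norm (dY t) \<le> a + b * norm (Y t)"
      and derivative: "\<And>t. 0 \<le> t \<Longrightarrow> t \<notin> N \<Longrightarrow> 2 * (dY t \<bullet> q (Y t))
              \<le> - e * norm (Y t) ^ 2 + a * norm (Y t) + b * norm (Y t) * sqrt (norm (Y t))"
    show "\<exists>t\<ge>0. Y t \<bullet> q (Y t) \<le> c"
    proof (rule reaches_sublevel_set[OF \<open>bounded_linear q\<close> q_sym q_nonneg Y \<open>negligible N\<close> growth])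
      fix t
      assume t: "0 \<le> t" "t \<notin> N" and "c < Y t \<bullet> q (Y t)"
      have "R \<le> norm (Y t)"
      proof (rule ccontr)
        assume "\<not> R \<le> norm (Y t)"
        then have "norm (Y t) ^ 2 \<le> R\<^sup>2"
          by (intro power_mono) auto
        then have "K * norm (Y t) ^ 2 \<le> K * R\<^sup>2"
          using \<open>0 \<le> K\<close> by (rule mult_left_mono)
        then have "Y t \<bullet> q (Y t) \<le> K * R\<^sup>2"
          using form_le[of "Y t"] by linarith
        with \<open>c < Y t \<bullet> q (Y t)\<close> show False
          by (simp add: c_def)
      qed
      with R[of "norm (Y t)"] derivative[OF t] show "2 * (dY t \<bullet> q (Y t)) \<le> -1"
        by linarith
    qed
  qed
qed

lemma sublevel_set_bounded_neighbourhood: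
  fixes Q :: "'a::real_normed_vector \<Rightarrow> real"
  assumes "0 < m" and lower: "\<And>x. m * norm x ^ 2 \<le> Q x" and upper: "\<And>x. Q x \<le> M * norm x ^ 2"
    and "0 < c"
  shows "bounded {x. Q x \<le> c}" and "0 \<in> interior {x. Q x \<le> c}"
proof -
  have "norm x \<le> sqrt (c / m)" if "Q x \<le> c" for x
  proof (rule real_le_rsqrt)
    show "norm x ^ 2 \<le> c / m"
      using lower[of x] that \<open>0 < m\<close> by (simp add: field_simps)
  qed
  then show "bounded {x. Q x \<le> c}"
    unfolding bounded_iff by blast
  define r where "r = sqrt (c / (\<bar>M\<bar> + 1))"
  have "0 < r"
    using \<open>0 < c\<close> by (simp add: r_def)
  have "Q x \<le> c" if "norm x < r" for x
  proof -
    have "norm x ^ 2 \<le> r\<^sup>2"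
      using that by (intro power_mono) auto
    also have "r\<^sup>2 = c / (\<bar>M\<bar> + 1)"
      using \<open>0 < c\<close> by (simp add: r_def)
    finally have "norm x ^ 2 \<le> c / (\<bar>M\<bar> + 1)" .
    then have "(\<bar>M\<bar> + 1) * norm x ^ 2 \<le> c"
      by (simp add: field_simps)
    moreover have "M * norm x ^ 2 \<le> (\<bar>M\<bar> + 1) * norm x ^ 2"
      by (intro mult_right_mono) auto
    ultimately show ?thesis
      using upper[of x] by linarith
  qed
  then have "ball 0 r \<subseteq> {x. Q x \<le> c}"
    by auto
  then have "ball 0 r \<subseteq> interior {x. Q x \<le> c}"
    by (rule interior_maximal) simp
  with \<open>0 < r\<close> show "0 \<in> interior {x. Q x \<le> c}"
    by auto
qed

section \<open>The closed loop as a perturbed linear system\<close>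

lemma absolutely_integrable_has_integral_increment:
  fixes f :: "'a::euclidean_space \<Rightarrow> 'b::euclidean_space"
  assumes "f absolutely_integrable_on S" and "y = y0 + integral S f"
  shows "(f has_integral (y - y0)) S"
  using integrable_integral[OF set_lebesgue_integral_eq_integral(1)[OF assms(1)]] assms(2) by simp

lemma has_integral_derivative_increment:
  fixes f f' :: "real \<Rightarrow> 'a::banach"
  assumes "\<And>t. 0 \<le> t \<Longrightarrow> (f has_vector_derivative f' t) (at t within {0..})" and "0 \<le> t"
  shows "(f' has_integral (f t - f 0)) {0..t}"
proof (rule fundamental_theorem_of_calculus[OF \<open>0 \<le> t\<close>])
  fix s
  assume "s \<in> {0..t}"
  then have "(f has_vector_derivative f' s) (at s within {0..})"
    by (simp add: assms(1))
  then show "(f has_vector_derivative f' s) (at s within {0..t})"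
    by (rule has_vector_derivative_within_subset) auto
qed

lemma AE_lborel_negligible:
  assumes "AE t in lborel. P t"
  obtains N where "negligible N" and "\<And>t. t \<notin> N \<Longrightarrow> P t"
proof -
  obtain N where "\<And>t. t \<in> space lborel - N \<Longrightarrow> P t" and "N \<in> null_sets lborel"
    using AE_E3[OF assms] by blast
  moreover from \<open>N \<in> null_sets lborel\<close> have "negligible N"
    by (simp add: negligible_iff_null_sets null_sets_completionI)
  ultimately show ?thesis
    using that by simp
qed

lemma norm_add4_le: "norm (a + b + c + d) \<le> norm a + norm b + norm c + norm (d :: 'a::real_normed_vector)"
  by (rule order_trans[OF norm_triangle_ineq]) (use norm_triangle_ineq3 norm_triangle_ineq in \<open>smt (verit)\<close>)

lemma sqrt_le_one_plus:
  assumes "0 \<le> x"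
  shows "sqrt x \<le> 1 + x"
proof -
  have "x \<le> (1 + x)\<^sup>2"
    using assms mult_nonneg_nonneg[OF assms assms] by (simp add: power2_eq_square algebra_simps)
  then have "sqrt x \<le> sqrt ((1 + x)\<^sup>2)"
    by (rule real_sqrt_le_mono)
  with assms show ?thesis
    by simp
qed

lemma cgain_sub_const: "\<sigma> \<noteq> 0 \<Longrightarrow> cgain alpha \<sigma> - alpha = 1 / sqrt (norm \<sigma>)"
  by (simp add: cgain_def)

lemma norm_cgain_sq_sub_const:
  assumes "\<sigma> \<noteq> 0" and "0 \<le> alpha"
  shows "norm (((cgain alpha \<sigma>)\<^sup>2 - alpha\<^sup>2) *\<^sub>R \<sigma>) = 1 + 2 * alpha * sqrt (norm \<sigma>)"
proof -
  have "0 < norm \<sigma>"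
    using assms(1) by simp
  have gain: "(cgain alpha \<sigma>)\<^sup>2 - alpha\<^sup>2 = 1 / norm \<sigma> + 2 * alpha / sqrt (norm \<sigma>)"
    by (simp add: cgain_def power2_sum power_divide)
  have "0 \<le> 1 / norm \<sigma> + 2 * alpha / sqrt (norm \<sigma>)"
    using assms(2) by simp
  then have "norm (((cgain alpha \<sigma>)\<^sup>2 - alpha\<^sup>2) *\<^sub>R \<sigma>) = (1 / norm \<sigma> + 2 * alpha / sqrt (norm \<sigma>)) * norm \<sigma>"
    by (simp only: gain norm_scaleR abs_of_nonneg)
  also have "\<dots> = 1 + 2 * alpha * sqrt (norm \<sigma>)"
    using \<open>0 < norm \<sigma>\<close> by (simp add: field_simps real_div_sqrt)
  finally show ?thesis .
qed

lemma norm_mult_div_sqrt_le: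
  fixes M :: "real^'a^'b"
  assumes "\<sigma> \<noteq> 0"
  shows "norm ((1 / sqrt (norm \<sigma>)) *\<^sub>R (M *v \<sigma>)) \<le> onorm ((*v) M) * sqrt (norm \<sigma>)"
proof -
  have "norm ((1 / sqrt (norm \<sigma>)) *\<^sub>R (M *v \<sigma>)) \<le> (1 / sqrt (norm \<sigma>)) * (onorm ((*v) M) * norm \<sigma>)"
    using norm_matrix_vector_mult_le[of M \<sigma>] by (simp add: divide_right_mono)
  also have "\<dots> = onorm ((*v) M) * sqrt (norm \<sigma>)"
    using assms by (simp add: field_simps real_div_sqrt)
  finally show ?thesis .
qed

locale lmi_design =
  fixes A :: "real^'r^'r" and E :: "real^'n^'r" and C :: "real^'r^'n" and D :: "real^'n^'n"
    and B :: "real^'m^'n" and K0 :: "real^'r^'m" and K1 K2 :: "real^'n^'m"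
    and f f' :: "real \<Rightarrow> real^'n"
    and S :: "real^'r^'r" and P :: "real^('n + 'n)^('n + 'n)"
    and alpha rho piz kappa e F :: real
  assumes S_pos: "pos_def S" and P_pos: "pos_def P"
    and alpha_pos: "0 < alpha" and piz_pos: "0 < piz" and kappa_pos: "0 < kappa" and e_pos: "0 < e"
    and BK2_invertible: "invertible (B ** K2)"
    and f_deriv: "\<And>t. 0 \<le> t \<Longrightarrow> (f has_vector_derivative f' t) (at t within {0..})"
    and f'_bound: "\<And>t. 0 \<le> t \<Longrightarrow> norm (f' t) \<le> F"
    and LMI1: "\<And>z \<xi>. 2 * ((A *v z) \<bullet> (S *v z)) + rho * (z \<bullet> (S *v z))
              + (2/alpha) * ((E *v (G0 *v \<xi>)) \<bullet> (S *v z)) - rho * (\<xi> \<bullet> (P *v \<xi>))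
            \<le> - e * (norm z ^ 2 + norm \<xi> ^ 2)"
    and LMI2: "\<And>\<xi>. 2 * ((AK B K1 K2 *v \<xi>) \<bullet> (P *v \<xi>)) + (piz + kappa) * norm (G0 *v (P *v \<xi>)) ^ 2
          + norm (D *v (G0 *v \<xi>)) ^ 2 / (piz * alpha\<^sup>2) + rho * (\<xi> \<bullet> (P *v \<xi>)) \<le> 0"
    and LMI3: "\<And>z. norm (C0 C B K0 *v z) ^ 2 / kappa \<le> rho * (z \<bullet> (S *v z))"
begin

text \<open>The closed loop in the coordinates \<open>z = \<eta> + (B K\<^sub>2)\<^sup>-\<^sup>1 f\<close>: the linear loop with the
  constant gain \<open>\<alpha>\<close> in place of \<open>c(\<sigma>)\<close>, up to errors of order \<open>\<surd>|\<sigma>|\<close>.\<close>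

definition near_linear_loop ::
    "real^'r \<Rightarrow> real^'n \<Rightarrow> real^'n \<Rightarrow> real^'r \<Rightarrow> real^'n \<Rightarrow> real^'n \<Rightarrow> bool" where
  "near_linear_loop \<zeta> \<sigma> z d\<zeta> d\<sigma> dz \<longleftrightarrow>
     d\<zeta> = A *v \<zeta> + E *v \<sigma> \<and>
     norm (d\<sigma> - (C0 C B K0 *v \<zeta> + D *v \<sigma> + alpha *\<^sub>R (B *v (K1 *v \<sigma>)) + B *v (K2 *v z)))
       \<le> onorm ((*v) (B ** K1)) * sqrt (norm \<sigma>) \<and>
     norm (dz - alpha\<^sup>2 *\<^sub>R \<sigma>) \<le> 1 + onorm ((*v) (matrix_inv (B ** K2))) * F + 2 * alpha * sqrt (norm \<sigma>)"

lemma F_nonneg: "0 \<le> F"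
  using norm_ge_zero[of "f' 0"] f'_bound[of 0] by linarith

lemma control_law_near_linear:
  assumes "d\<zeta> = A *v \<zeta> + E *v \<sigma>"
    and nonzero: "\<sigma> \<noteq> 0 \<Longrightarrow> d\<sigma> = C *v \<zeta> + D *v \<sigma>
              + B *v (K0 *v \<zeta> + cgain alpha \<sigma> *\<^sub>R (K1 *v \<sigma>) + K2 *v \<eta>) + \<phi>
            \<and> d\<eta> = (cgain alpha \<sigma>)\<^sup>2 *\<^sub>R \<sigma>"
    and zero: "\<sigma> = 0 \<Longrightarrow> d\<sigma> = C *v \<zeta> + D *v \<sigma> + B *v (K0 *v \<zeta> + K2 *v \<eta>) + \<phi> \<and> norm d\<eta> \<le> 1"
    and "norm \<phi>' \<le> F"
  shows "near_linear_loop \<zeta> \<sigma> (\<eta> + matrix_inv (B ** K2) *v \<phi>) d\<zeta> d\<sigma> (d\<eta> + matrix_inv (B ** K2) *v \<phi>')"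
proof -
  let ?M = "matrix_inv (B ** K2)"
  have "B *v (K2 *v (?M *v \<phi>)) = ((B ** K2) ** ?M) *v \<phi>"
    by (simp only: matrix_vector_mul_assoc matrix_mul_assoc)
  then have B_z: "B *v (K2 *v (?M *v \<phi>)) = \<phi>"
    by (simp add: matrix_mul_matrix_inv[OF BK2_invertible])
  have C0: "C0 C B K0 *v \<zeta> = C *v \<zeta> + B *v (K0 *v \<zeta>)"
    by (simp add: C0_def matrix_vector_mult_add_rdistrib matrix_vector_mul_assoc)
  have f'_term: "norm (?M *v \<phi>') \<le> onorm ((*v) ?M) * F"
    using norm_matrix_vector_mult_le[of ?M \<phi>'] \<open>norm \<phi>' \<le> F\<close> onorm_matrix_nonneg[of ?M]
    by (meson mult_left_mono order_trans)
  show ?thesis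
  proof (cases "\<sigma> = 0")
    case True
    with zero have "d\<sigma> = C *v \<zeta> + D *v \<sigma> + B *v (K0 *v \<zeta> + K2 *v \<eta>) + \<phi>" and "norm d\<eta> \<le> 1"
      by auto
    with True f'_term show ?thesis
      using \<open>d\<zeta> = A *v \<zeta> + E *v \<sigma>\<close> norm_triangle_ineq[of d\<eta> "?M *v \<phi>'"]
      by (simp add: near_linear_loop_def B_z C0 algebra_simps)
  next
    case False
    from nonzero[OF False] have d\<sigma>: "d\<sigma> = C *v \<zeta> + D *v \<sigma>
        + B *v (K0 *v \<zeta> + cgain alpha \<sigma> *\<^sub>R (K1 *v \<sigma>) + K2 *v \<eta>) + \<phi>"
      and d\<eta>: "d\<eta> = (cgain alpha \<sigma>)\<^sup>2 *\<^sub>R \<sigma>"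
      by auto
    have "d\<sigma> - (C0 C B K0 *v \<zeta> + D *v \<sigma> + alpha *\<^sub>R (B *v (K1 *v \<sigma>)) + B *v (K2 *v (\<eta> + ?M *v \<phi>)))
        = (1 / sqrt (norm \<sigma>)) *\<^sub>R ((B ** K1) *v \<sigma>)"
      using cgain_sub_const[OF False, of alpha]
      by (simp add: d\<sigma> B_z C0 algebra_simps flip: matrix_vector_mul_assoc scaleR_diff_left)
    with norm_mult_div_sqrt_le[OF False, of "B ** K1"]
    have rs: "norm (d\<sigma> - (C0 C B K0 *v \<zeta> + D *v \<sigma> + alpha *\<^sub>R (B *v (K1 *v \<sigma>))
        + B *v (K2 *v (\<eta> + ?M *v \<phi>)))) \<le> onorm ((*v) (B ** K1)) * sqrt (norm \<sigma>)"
      by simp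
    have dz: "d\<eta> + ?M *v \<phi>' - alpha\<^sup>2 *\<^sub>R \<sigma> = ((cgain alpha \<sigma>)\<^sup>2 - alpha\<^sup>2) *\<^sub>R \<sigma> + ?M *v \<phi>'"
      by (simp add: d\<eta> algebra_simps)
    have rz: "norm (d\<eta> + ?M *v \<phi>' - alpha\<^sup>2 *\<^sub>R \<sigma>)
        \<le> 1 + onorm ((*v) ?M) * F + 2 * alpha * sqrt (norm \<sigma>)"
      using norm_triangle_ineq[of "((cgain alpha \<sigma>)\<^sup>2 - alpha\<^sup>2) *\<^sub>R \<sigma>" "?M *v \<phi>'"] f'_term
        norm_cgain_sq_sub_const[OF False less_imp_le[OF alpha_pos]]
      unfolding dz by linarith
    from \<open>d\<zeta> = A *v \<zeta> + E *v \<sigma>\<close> rs rz show ?thesis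
      by (simp only: near_linear_loop_def)
  qed
qed

section \<open>A quadratic Lyapunov function for the closed loop\<close>

text \<open>\<open>R\<^sub>\<alpha>\<close> is the scaling \<open>R(\<sigma>) = diag(c(\<sigma>) I, I)\<close> of the paper with \<open>c(\<sigma>)\<close> frozen at its
  constant part \<open>\<alpha>\<close>; the Lyapunov function is \<open>\<zeta>\<^sup>T S \<zeta> + \<alpha>\<^sup>-\<^sup>1 x\<^sup>T R\<^sub>\<alpha> P R\<^sub>\<alpha> x\<close>.\<close>

definition Ralpha :: "real^('n + 'n)^('n + 'n)" where
  "Ralpha = block2 (alpha *\<^sub>R mat 1) 0 0 (mat 1)"

definition lyap_coords :: "(real^'r) \<times> (real^('n + 'n)) \<Rightarrow> (real^'r) \<times> (real^('n + 'n))" where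
  "lyap_coords p = (fst p, Ralpha *v snd p)"

definition lyap_form :: "(real^'r) \<times> (real^('n + 'n)) \<Rightarrow> (real^'r) \<times> (real^('n + 'n))" where
  "lyap_form y = (S *v fst y, (1 / alpha) *\<^sub>R (P *v snd y))"

lemma lyap_coords_vcat [simp]: "lyap_coords (\<zeta>, vcat \<sigma> z) = (\<zeta>, vcat (alpha *\<^sub>R \<sigma>) z)"
  by (simp add: lyap_coords_def Ralpha_def block2_mult_vcat flip: scaleR_matrix_vector_assoc)

lemma bounded_linear_lyap_coords: "bounded_linear lyap_coords"
  unfolding lyap_coords_def
  by (intro bounded_linear_Pair bounded_linear_fst
      bounded_linear_compose[OF matrix_vector_mul_bounded_linear bounded_linear_snd])

lemma bounded_linear_lyap_form: "bounded_linear lyap_form"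
  unfolding lyap_form_def
  by (intro bounded_linear_Pair bounded_linear_compose[OF matrix_vector_mul_bounded_linear bounded_linear_fst]
      bounded_linear_compose[OF bounded_linear_scaleR_right
        bounded_linear_compose[OF matrix_vector_mul_bounded_linear bounded_linear_snd]])

lemma inner_lyap_form: "y \<bullet> lyap_form w = fst y \<bullet> (S *v fst w) + (snd y \<bullet> (P *v snd w)) / alpha"
  by (simp add: lyap_form_def inner_prod_def)

lemma lyap_form_symmetric: "y \<bullet> lyap_form w = w \<bullet> lyap_form y"
  using inner_symmetric_mult[OF pos_def_symmetric[OF S_pos], of "fst y" "fst w"]
    inner_symmetric_mult[OF pos_def_symmetric[OF P_pos], of "snd y" "snd w"]
  by (simp add: inner_lyap_form inner_commute)

lemma lyap_form_nonneg: "0 \<le> y \<bullet> lyap_form y"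
  using pos_def_nonneg[OF S_pos, of "fst y"] pos_def_nonneg[OF P_pos, of "snd y"] alpha_pos
  by (simp add: inner_lyap_form)

lemma norm_lyap_coords_bounds:
  shows "min 1 (alpha\<^sup>2) * norm p ^ 2 \<le> norm (lyap_coords p) ^ 2"
    and "norm (lyap_coords p) ^ 2 \<le> max 1 (alpha\<^sup>2) * norm p ^ 2"
proof -
  obtain \<zeta> \<sigma> z where p: "p = (\<zeta>, vcat \<sigma> z)"
    by (metis prod.exhaust vcat_cases)
  have np: "norm p ^ 2 = norm \<zeta> ^ 2 + norm \<sigma> ^ 2 + norm z ^ 2"
    by (simp add: p norm_Pair_power2 norm_vcat_power2)
  have ny: "norm (lyap_coords p) ^ 2 = norm \<zeta> ^ 2 + alpha\<^sup>2 * norm \<sigma> ^ 2 + norm z ^ 2"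
    by (simp add: p norm_Pair_power2 norm_vcat_power2 power_mult_distrib)
  have weights: "min 1 (alpha\<^sup>2) * x \<le> x" "min 1 (alpha\<^sup>2) * x \<le> alpha\<^sup>2 * x"
    "x \<le> max 1 (alpha\<^sup>2) * x" "alpha\<^sup>2 * x \<le> max 1 (alpha\<^sup>2) * x" if "0 \<le> x" for x
    using mult_right_mono[OF min.cobounded1[of 1 "alpha\<^sup>2"] that]
      mult_right_mono[OF min.cobounded2[of 1 "alpha\<^sup>2"] that]
      mult_right_mono[OF max.cobounded1[of 1 "alpha\<^sup>2"] that]
      mult_right_mono[OF max.cobounded2[of 1 "alpha\<^sup>2"] that] by simp_all
  show "min 1 (alpha\<^sup>2) * norm p ^ 2 \<le> norm (lyap_coords p) ^ 2"
    and "norm (lyap_coords p) ^ 2 \<le> max 1 (alpha\<^sup>2) * norm p ^ 2"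
    using weights[of "norm \<zeta> ^ 2"] weights[of "norm \<sigma> ^ 2"] weights[of "norm z ^ 2"]
    unfolding np ny by (simp_all add: distrib_left)
qed

lemma lyap_form_coercive:
  obtains m where "0 < m" and "\<And>y. m * norm y ^ 2 \<le> y \<bullet> lyap_form y"
proof -
  obtain mS where "0 < mS" and mS: "\<And>x. mS * norm x ^ 2 \<le> x \<bullet> (S *v x)"
    using pos_def_coercive[OF S_pos] by blast
  obtain mP where "0 < mP" and mP: "\<And>x. mP * norm x ^ 2 \<le> x \<bullet> (P *v x)"
    using pos_def_coercive[OF P_pos] by blast
  have "min mS (mP / alpha) * norm y ^ 2 \<le> y \<bullet> lyap_form y" for y
  proof -
    have "min mS (mP / alpha) * norm y ^ 2
        = min mS (mP / alpha) * norm (fst y) ^ 2 + min mS (mP / alpha) * norm (snd y) ^ 2"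
      by (simp add: norm_Pair_power2[of "fst y" "snd y", simplified] distrib_left)
    also have "\<dots> \<le> mS * norm (fst y) ^ 2 + (mP / alpha) * norm (snd y) ^ 2"
      by (intro add_mono mult_right_mono) simp_all
    also have "\<dots> \<le> y \<bullet> lyap_form y"
      using mS[of "fst y"] mP[of "snd y"] alpha_pos
      by (simp add: inner_lyap_form add_mono divide_right_mono)
    finally show ?thesis .
  qed
  moreover have "0 < min mS (mP / alpha)"
    using \<open>0 < mS\<close> \<open>0 < mP\<close> alpha_pos by simp
  ultimately show ?thesis
    using that by blast
qed

lemma lyap_form_le: "y \<bullet> lyap_form y \<le> (onorm ((*v) S) + onorm ((*v) P) / alpha) * norm y ^ 2"
proof -
  have "y \<bullet> lyap_form y \<le> onorm ((*v) S) * norm (fst y) ^ 2 + onorm ((*v) P) / alpha * norm (snd y) ^ 2"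
    using quadratic_form_le_onorm[of "fst y" S] quadratic_form_le_onorm[of "snd y" P] alpha_pos
    by (simp add: inner_lyap_form add_mono divide_right_mono)
  also have "\<dots> \<le> (onorm ((*v) S) + onorm ((*v) P) / alpha) * norm y ^ 2"
    using onorm_matrix_nonneg[of S] onorm_matrix_nonneg[of P] alpha_pos
    by (simp add: norm_Pair_power2[of "fst y" "snd y", simplified] algebra_simps)
  finally show ?thesis .
qed

lemma lyap_value_bounds:
  obtains m M where "0 < m"
    and "\<And>p. m * norm p ^ 2 \<le> lyap_coords p \<bullet> lyap_form (lyap_coords p)"
    and "\<And>p. lyap_coords p \<bullet> lyap_form (lyap_coords p) \<le> M * norm p ^ 2"
proof -
  obtain m where "0 < m" and m: "\<And>y. m * norm y ^ 2 \<le> y \<bullet> lyap_form y"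
    using lyap_form_coercive by blast
  define M where "M = onorm ((*v) S) + onorm ((*v) P) / alpha"
  have "0 \<le> M"
    using onorm_matrix_nonneg[of S] onorm_matrix_nonneg[of P] alpha_pos by (simp add: M_def)
  have "m * min 1 (alpha\<^sup>2) * norm p ^ 2 \<le> lyap_coords p \<bullet> lyap_form (lyap_coords p)" for p
    using mult_left_mono[OF norm_lyap_coords_bounds(1)[of p] less_imp_le[OF \<open>0 < m\<close>]] m[of "lyap_coords p"]
    by (simp add: mult.assoc)
  moreover have "lyap_coords p \<bullet> lyap_form (lyap_coords p) \<le> M * max 1 (alpha\<^sup>2) * norm p ^ 2" for p
    using mult_left_mono[OF norm_lyap_coords_bounds(2)[of p] \<open>0 \<le> M\<close>] lyap_form_le[of "lyap_coords p"]
    by (simp add: M_def mult.assoc)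
  moreover have "0 < m * min 1 (alpha\<^sup>2)"
    using \<open>0 < m\<close> alpha_pos by simp
  ultimately show ?thesis
    using that by blast
qed

text \<open>Summing the three LMIs: the \<open>\<rho>\<close>-terms cancel, the cross terms of \<open>\<zeta>\<close> and \<open>\<sigma>\<close> are
  absorbed by Young's inequality with the weights \<open>\<pi>\<close> and \<open>\<kappa>\<close>, and only the perturbation
  is left over.\<close>

lemma lyapunov_derivative_le:
  assumes d\<zeta>: "d\<zeta> = A *v \<zeta> + E *v \<sigma>"
    and d\<sigma>: "d\<sigma> = C0 C B K0 *v \<zeta> + D *v \<sigma> + alpha *\<^sub>R (B *v (K1 *v \<sigma>)) + B *v (K2 *v z) + rs"
    and dz: "dz = alpha\<^sup>2 *\<^sub>R \<sigma> + rz"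
  shows "2 * (lyap_coords (d\<zeta>, vcat d\<sigma> dz) \<bullet> lyap_form (lyap_coords (\<zeta>, vcat \<sigma> z)))
     \<le> - e * norm (lyap_coords (\<zeta>, vcat \<sigma> z)) ^ 2
       + (2 / alpha) * (vcat (alpha *\<^sub>R rs) rz \<bullet> (P *v vcat (alpha *\<^sub>R \<sigma>) z))"
proof -
  define \<xi> where "\<xi> = vcat (alpha *\<^sub>R \<sigma>) z"
  obtain p1 p2 where p: "P *v \<xi> = vcat p1 p2"
    by (rule vcat_cases)
  have G_p: "G0 *v (P *v \<xi>) = p1"
    by (simp add: p G0_mult_vcat)
  have G_\<xi>: "G0 *v \<xi> = alpha *\<^sub>R \<sigma>"
    by (simp add: \<xi>_def G0_mult_vcat)
  have "vcat (alpha *\<^sub>R d\<sigma>) dz = alpha *\<^sub>R (AK B K1 K2 *v \<xi>)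
      + vcat (D *v (alpha *\<^sub>R \<sigma>) + alpha *\<^sub>R (C0 C B K0 *v \<zeta>)) 0 + vcat (alpha *\<^sub>R rs) rz"
    by (simp add: \<xi>_def AK_mult_vcat vcat_scaleR vcat_add d\<sigma> dz algebra_simps power2_eq_square)
  then have x_part: "(2 / alpha) * (vcat (alpha *\<^sub>R d\<sigma>) dz \<bullet> (P *v \<xi>))
      = 2 * ((AK B K1 K2 *v \<xi>) \<bullet> (P *v \<xi>)) + 2 * (p1 \<bullet> ((1 / alpha) *\<^sub>R (D *v (alpha *\<^sub>R \<sigma>))))
        + 2 * (p1 \<bullet> (C0 C B K0 *v \<zeta>)) + (2 / alpha) * (vcat (alpha *\<^sub>R rs) rz \<bullet> (P *v \<xi>))"
    using alpha_pos by (simp add: p inner_vcat inner_commute algebra_simps)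
  have young_D: "2 * (p1 \<bullet> ((1 / alpha) *\<^sub>R (D *v (alpha *\<^sub>R \<sigma>))))
      \<le> piz * norm p1 ^ 2 + norm (D *v (G0 *v \<xi>)) ^ 2 / (piz * alpha\<^sup>2)"
    using young_inner[OF piz_pos, of p1 "(1 / alpha) *\<^sub>R (D *v (alpha *\<^sub>R \<sigma>))"] alpha_pos
    by (simp add: G_\<xi> field_simps)
  have young_C: "2 * (p1 \<bullet> (C0 C B K0 *v \<zeta>)) \<le> kappa * norm p1 ^ 2 + norm (C0 C B K0 *v \<zeta>) ^ 2 / kappa"
    by (rule young_inner[OF kappa_pos])
  have \<zeta>_part: "2 * (d\<zeta> \<bullet> (S *v \<zeta>))
      = 2 * ((A *v \<zeta>) \<bullet> (S *v \<zeta>)) + (2 / alpha) * ((E *v (G0 *v \<xi>)) \<bullet> (S *v \<zeta>))"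
    using alpha_pos by (simp add: d\<zeta> G_\<xi> inner_add_left matrix_vector_mult_scaleR)
  have "2 * (lyap_coords (d\<zeta>, vcat d\<sigma> dz) \<bullet> lyap_form (lyap_coords (\<zeta>, vcat \<sigma> z)))
      = 2 * (d\<zeta> \<bullet> (S *v \<zeta>)) + (2 / alpha) * (vcat (alpha *\<^sub>R d\<sigma>) dz \<bullet> (P *v \<xi>))"
    by (simp add: inner_lyap_form \<xi>_def)
  moreover have "norm (lyap_coords (\<zeta>, vcat \<sigma> z)) ^ 2 = norm \<zeta> ^ 2 + norm \<xi> ^ 2"
    by (simp add: norm_Pair_power2 \<xi>_def)
  ultimately show ?thesis
    using x_part young_D young_C \<zeta>_part LMI1[of \<zeta> \<xi>] LMI2[of \<xi>] LMI3[of \<zeta>]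
    unfolding G_p \<xi>_def[symmetric] by (simp add: algebra_simps)
qed

lemma perturbation_term_le:
  fixes \<zeta> :: "real^'r" and \<sigma> z rs rz :: "real^'n"
  assumes rs: "norm rs \<le> kr * sqrt (norm \<sigma>)" and rz: "norm rz \<le> k0 + 2 * alpha * sqrt (norm \<sigma>)"
    and "0 \<le> kr" and "0 \<le> k0"
  defines "n \<equiv> norm (lyap_coords (\<zeta>, vcat \<sigma> z))" and "kP \<equiv> onorm ((*v) P)"
  shows "(2 / alpha) * (vcat (alpha *\<^sub>R rs) rz \<bullet> (P *v vcat (alpha *\<^sub>R \<sigma>) z))
    \<le> 2 * kP * k0 / alpha * n + 2 * kP * (kr + 2) / sqrt alpha * (n * sqrt n)"
proof -
  let ?\<xi> = "vcat (alpha *\<^sub>R \<sigma>) z" and ?v = "vcat (alpha *\<^sub>R rs) rz"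
  have "norm ?\<xi> \<le> n"
    using norm_snd_le[of ?\<xi> \<zeta>] by (simp add: n_def)
  then have "alpha * norm \<sigma> \<le> n"
    using norm_le_norm_vcat1[of "alpha *\<^sub>R \<sigma>" z] alpha_pos by simp
  then have "sqrt (norm \<sigma>) \<le> sqrt n / sqrt alpha"
    using alpha_pos by (simp add: real_sqrt_le_mono pos_le_divide_eq mult.commute flip: real_sqrt_divide)
  have "norm ?v \<le> alpha * norm rs + norm rz"
    using norm_vcat_le[of "alpha *\<^sub>R rs" rz] alpha_pos by simp
  also have "\<dots> \<le> alpha * (kr * sqrt (norm \<sigma>)) + (k0 + 2 * alpha * sqrt (norm \<sigma>))"
    using rs rz alpha_pos by (intro add_mono mult_left_mono) auto
  also have "\<dots> = k0 + alpha * (kr + 2) * sqrt (norm \<sigma>)"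
    by (simp add: algebra_simps)
  also have "\<dots> \<le> k0 + alpha * (kr + 2) * (sqrt n / sqrt alpha)"
    using \<open>sqrt (norm \<sigma>) \<le> sqrt n / sqrt alpha\<close> \<open>0 \<le> kr\<close> alpha_pos by (intro add_left_mono mult_left_mono) auto
  finally have v: "norm ?v \<le> k0 + alpha * (kr + 2) * (sqrt n / sqrt alpha)" .
  have P\<xi>: "norm (P *v ?\<xi>) \<le> kP * n"
    using norm_matrix_vector_mult_le[of P ?\<xi>] \<open>norm ?\<xi> \<le> n\<close> onorm_matrix_nonneg[of P]
    by (simp add: kP_def) (meson mult_left_mono order_trans)
  have "?v \<bullet> (P *v ?\<xi>) \<le> (k0 + alpha * (kr + 2) * (sqrt n / sqrt alpha)) * (kP * n)"
  proof -
    have "0 \<le> k0 + alpha * (kr + 2) * (sqrt n / sqrt alpha)"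
      using \<open>0 \<le> k0\<close> \<open>0 \<le> kr\<close> alpha_pos by (simp add: n_def)
    then show ?thesis
      using norm_cauchy_schwarz[of ?v "P *v ?\<xi>"] mult_mono[OF v P\<xi> _ norm_ge_zero] by linarith
  qed
  then have "(2 / alpha) * (?v \<bullet> (P *v ?\<xi>))
      \<le> (2 / alpha) * ((k0 + alpha * (kr + 2) * (sqrt n / sqrt alpha)) * (kP * n))"
    using alpha_pos by (intro mult_left_mono) auto
  also have "\<dots> = 2 * kP * k0 / alpha * n + 2 * kP * (kr + 2) / sqrt alpha * (n * sqrt n)"
    using alpha_pos by (simp add: field_simps real_div_sqrt)
  finally show ?thesis .
qed

lemma norm_le_lyap_coords:
  fixes \<zeta> :: "real^'r" and \<sigma> z :: "real^'n"
  defines "n \<equiv> norm (lyap_coords (\<zeta>, vcat \<sigma> z))"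
  shows "norm \<zeta> \<le> n" and "norm z \<le> n" and "alpha * norm \<sigma> \<le> n" and "alpha * sqrt (norm \<sigma>) \<le> alpha + n"
proof -
  show "norm \<zeta> \<le> n" and "norm z \<le> n" and "alpha * norm \<sigma> \<le> n"
    using norm_fst_le[of \<zeta> "vcat (alpha *\<^sub>R \<sigma>) z"] norm_snd_le[of "vcat (alpha *\<^sub>R \<sigma>) z" \<zeta>]
      norm_le_norm_vcat1[of "alpha *\<^sub>R \<sigma>" z] norm_le_norm_vcat2[of z "alpha *\<^sub>R \<sigma>"] alpha_pos
    by (simp_all add: n_def)
  then show "alpha * sqrt (norm \<sigma>) \<le> alpha + n"
    using mult_left_mono[OF sqrt_le_one_plus[OF norm_ge_zero[of \<sigma>]] less_imp_le[OF alpha_pos]]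
    by (simp add: algebra_simps)
qed

lemma near_linear_loop_zeta_le:
  assumes "near_linear_loop \<zeta> \<sigma> z d\<zeta> d\<sigma> dz"
  shows "norm d\<zeta> \<le> (onorm ((*v) A) + onorm ((*v) E) / alpha) * norm (lyap_coords (\<zeta>, vcat \<sigma> z))"
proof -
  let ?n = "norm (lyap_coords (\<zeta>, vcat \<sigma> z))"
  have "norm \<sigma> \<le> ?n / alpha"
    using norm_le_lyap_coords(3)[where \<zeta> = \<zeta> and \<sigma> = \<sigma> and z = z] alpha_pos by (simp add: field_simps)
  have "norm d\<zeta> \<le> onorm ((*v) A) * ?n + onorm ((*v) E) * (?n / alpha)"
    using assms norm_triangle_ineq[of "A *v \<zeta>" "E *v \<sigma>"]
      norm_matrix_vector_mult_le_bound[OF norm_le_lyap_coords(1)[where \<zeta> = \<zeta> and \<sigma> = \<sigma> and z = z], of A]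
      norm_matrix_vector_mult_le_bound[OF \<open>norm \<sigma> \<le> ?n / alpha\<close>, of E]
    by (simp add: near_linear_loop_def)
  then show ?thesis
    by (simp add: algebra_simps)
qed

lemma near_linear_loop_sigma_le:
  assumes "near_linear_loop \<zeta> \<sigma> z d\<zeta> d\<sigma> dz"
  defines "n \<equiv> norm (lyap_coords (\<zeta>, vcat \<sigma> z))" and "kr \<equiv> onorm ((*v) (B ** K1))"
  shows "alpha * norm d\<sigma> \<le> alpha * kr
           + (alpha * onorm ((*v) (C0 C B K0)) + onorm ((*v) D) + alpha * kr + alpha * onorm ((*v) (B ** K2)) + kr) * n"
proof -
  note n = norm_le_lyap_coords[where \<zeta> = \<zeta> and \<sigma> = \<sigma> and z = z, folded n_def]
  have "0 \<le> kr"
    by (simp add: kr_def onorm_matrix_nonneg)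
  have d\<sigma>_le: "norm d\<sigma> \<le> norm (C0 C B K0 *v \<zeta>) + norm (D *v \<sigma>) + norm (alpha *\<^sub>R ((B ** K1) *v \<sigma>))
      + norm ((B ** K2) *v z) + kr * sqrt (norm \<sigma>)"
    using assms(1) norm_add4_le[of "C0 C B K0 *v \<zeta>" "D *v \<sigma>" "alpha *\<^sub>R ((B ** K1) *v \<sigma>)" "(B ** K2) *v z"]
      norm_triangle_sub[of d\<sigma> "C0 C B K0 *v \<zeta> + D *v \<sigma> + alpha *\<^sub>R ((B ** K1) *v \<sigma>) + (B ** K2) *v z"]
    by (simp add: near_linear_loop_def kr_def matrix_vector_mul_assoc)
  have "alpha * norm d\<sigma> \<le> alpha * norm (C0 C B K0 *v \<zeta>) + alpha * norm (D *v \<sigma>)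
      + alpha * (alpha * norm ((B ** K1) *v \<sigma>)) + alpha * norm ((B ** K2) *v z) + kr * (alpha * sqrt (norm \<sigma>))"
    using mult_left_mono[OF d\<sigma>_le less_imp_le[OF alpha_pos]] alpha_pos by (simp add: algebra_simps)
  moreover have "alpha * norm (C0 C B K0 *v \<zeta>) \<le> alpha * (onorm ((*v) (C0 C B K0)) * n)"
    and "alpha * norm ((B ** K2) *v z) \<le> alpha * (onorm ((*v) (B ** K2)) * n)"
    using norm_matrix_vector_mult_le_bound[OF n(1)] norm_matrix_vector_mult_le_bound[OF n(2)] alpha_pos
    by (auto intro: mult_left_mono)
  moreover have "alpha * norm (D *v \<sigma>) \<le> onorm ((*v) D) * n"
    and "alpha * norm ((B ** K1) *v \<sigma>) \<le> kr * n"
    using mult_left_mono[OF norm_matrix_vector_mult_le[of D \<sigma>] less_imp_le[OF alpha_pos]]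
      mult_left_mono[OF norm_matrix_vector_mult_le[of "B ** K1" \<sigma>] less_imp_le[OF alpha_pos]]
      mult_left_mono[OF n(3) onorm_matrix_nonneg[of D]] mult_left_mono[OF n(3) \<open>0 \<le> kr\<close>]
    by (simp_all add: kr_def algebra_simps)
  moreover have "kr * (alpha * sqrt (norm \<sigma>)) \<le> kr * (alpha + n)"
    using n(4) \<open>0 \<le> kr\<close> by (rule mult_left_mono)
  ultimately have "alpha * norm d\<sigma> \<le> alpha * (onorm ((*v) (C0 C B K0)) * n) + onorm ((*v) D) * n
      + alpha * (kr * n) + alpha * (onorm ((*v) (B ** K2)) * n) + kr * (alpha + n)"
    using mult_left_mono[OF \<open>alpha * norm ((B ** K1) *v \<sigma>) \<le> kr * n\<close> less_imp_le[OF alpha_pos]]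
    by linarith
  then show ?thesis
    by (simp add: algebra_simps)
qed

lemma near_linear_loop_z_le:
  assumes "near_linear_loop \<zeta> \<sigma> z d\<zeta> d\<sigma> dz"
  shows "norm dz \<le> 1 + onorm ((*v) (matrix_inv (B ** K2))) * F + 2 * alpha
           + (alpha + 2) * norm (lyap_coords (\<zeta>, vcat \<sigma> z))"
proof -
  note n = norm_le_lyap_coords[where \<zeta> = \<zeta> and \<sigma> = \<sigma> and z = z]
  have "norm dz \<le> alpha * (alpha * norm \<sigma>)
      + (1 + onorm ((*v) (matrix_inv (B ** K2))) * F + 2 * (alpha * sqrt (norm \<sigma>)))"
    using assms norm_triangle_sub[of dz "alpha\<^sup>2 *\<^sub>R \<sigma>"] alpha_pos
    by (simp add: near_linear_loop_def power2_eq_square)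
  then show ?thesis
    using n(4) mult_left_mono[OF n(3) less_imp_le[OF alpha_pos]] by (simp only: distrib_right)
qed

lemma near_linear_loop_growth:
  assumes "near_linear_loop \<zeta> \<sigma> z d\<zeta> d\<sigma> dz"
  defines "kr \<equiv> onorm ((*v) (B ** K1))" and "k0 \<equiv> 1 + onorm ((*v) (matrix_inv (B ** K2))) * F"
  shows "norm (lyap_coords (d\<zeta>, vcat d\<sigma> dz)) \<le> (alpha * kr + k0 + 2 * alpha)
    + (onorm ((*v) A) + onorm ((*v) E) / alpha + alpha * onorm ((*v) (C0 C B K0)) + onorm ((*v) D)
       + alpha * kr + alpha * onorm ((*v) (B ** K2)) + kr + alpha + 2) * norm (lyap_coords (\<zeta>, vcat \<sigma> z))"
proof -
  have "norm (lyap_coords (d\<zeta>, vcat d\<sigma> dz)) \<le> norm d\<zeta> + (alpha * norm d\<sigma> + norm dz)"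
    using norm_Pair_le[of d\<zeta> "vcat (alpha *\<^sub>R d\<sigma>) dz"] norm_vcat_le[of "alpha *\<^sub>R d\<sigma>" dz] alpha_pos
    by simp
  with near_linear_loop_zeta_le[OF assms(1)] near_linear_loop_sigma_le[OF assms(1)]
    near_linear_loop_z_le[OF assms(1)]
  show ?thesis
    unfolding kr_def k0_def by (simp only: distrib_right)
qed

lemma near_linear_loop_lyapunov_le:
  assumes "near_linear_loop \<zeta> \<sigma> z d\<zeta> d\<sigma> dz"
  defines "n \<equiv> norm (lyap_coords (\<zeta>, vcat \<sigma> z))" and "kP \<equiv> onorm ((*v) P)"
    and "kr \<equiv> onorm ((*v) (B ** K1))" and "k0 \<equiv> 1 + onorm ((*v) (matrix_inv (B ** K2))) * F"
  shows "2 * (lyap_coords (d\<zeta>, vcat d\<sigma> dz) \<bullet> lyap_form (lyap_coords (\<zeta>, vcat \<sigma> z)))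
    \<le> - e * n ^ 2 + 2 * kP * k0 / alpha * n + 2 * kP * (kr + 2) / sqrt alpha * (n * sqrt n)"
proof -
  define rs where "rs = d\<sigma> - (C0 C B K0 *v \<zeta> + D *v \<sigma> + alpha *\<^sub>R (B *v (K1 *v \<sigma>)) + B *v (K2 *v z))"
  define rz where "rz = dz - alpha\<^sup>2 *\<^sub>R \<sigma>"
  have "d\<zeta> = A *v \<zeta> + E *v \<sigma>" and "norm rs \<le> kr * sqrt (norm \<sigma>)"
    and "norm rz \<le> k0 + 2 * alpha * sqrt (norm \<sigma>)"
    using assms(1) by (simp_all add: near_linear_loop_def rs_def rz_def kr_def k0_def)
  have "0 \<le> kr" and "0 \<le> k0"
    using F_nonneg by (auto simp: kr_def k0_def onorm_matrix_nonneg)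
  have "2 * (lyap_coords (d\<zeta>, vcat d\<sigma> dz) \<bullet> lyap_form (lyap_coords (\<zeta>, vcat \<sigma> z)))
      \<le> - e * n ^ 2 + (2 / alpha) * (vcat (alpha *\<^sub>R rs) rz \<bullet> (P *v vcat (alpha *\<^sub>R \<sigma>) z))"
    unfolding n_def
    by (rule lyapunov_derivative_le[OF \<open>d\<zeta> = A *v \<zeta> + E *v \<sigma>\<close>]) (simp_all add: rs_def rz_def)
  also have "(2 / alpha) * (vcat (alpha *\<^sub>R rs) rz \<bullet> (P *v vcat (alpha *\<^sub>R \<sigma>) z))
      \<le> 2 * kP * k0 / alpha * n + 2 * kP * (kr + 2) / sqrt alpha * (n * sqrt n)"
    using perturbation_term_le[OF \<open>norm rs \<le> _\<close> \<open>norm rz \<le> _\<close> \<open>0 \<le> kr\<close> \<open>0 \<le> k0\<close>, where \<zeta> = \<zeta> and z = z]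
    by (simp only: n_def kP_def)
  finally show ?thesis
    by simp
qed

lemma near_linear_loop_estimates:
  obtains a b where "0 \<le> a" and "0 \<le> b"
    and "\<And>\<zeta> \<sigma> z d\<zeta> d\<sigma> dz. near_linear_loop \<zeta> \<sigma> z d\<zeta> d\<sigma> dz \<Longrightarrow>
      norm (lyap_coords (d\<zeta>, vcat d\<sigma> dz)) \<le> a + b * norm (lyap_coords (\<zeta>, vcat \<sigma> z))"
    and "\<And>\<zeta> \<sigma> z d\<zeta> d\<sigma> dz. near_linear_loop \<zeta> \<sigma> z d\<zeta> d\<sigma> dz \<Longrightarrow>
      2 * (lyap_coords (d\<zeta>, vcat d\<sigma> dz) \<bullet> lyap_form (lyap_coords (\<zeta>, vcat \<sigma> z)))
        \<le> - e * norm (lyap_coords (\<zeta>, vcat \<sigma> z)) ^ 2 + a * norm (lyap_coords (\<zeta>, vcat \<sigma> z))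
          + b * norm (lyap_coords (\<zeta>, vcat \<sigma> z)) * sqrt (norm (lyap_coords (\<zeta>, vcat \<sigma> z)))"
proof -
  define kr where "kr = onorm ((*v) (B ** K1))"
  define k0 where "k0 = 1 + onorm ((*v) (matrix_inv (B ** K2))) * F"
  define kP where "kP = onorm ((*v) P)"
  define a0 where "a0 = alpha * kr + k0 + 2 * alpha"
  define b0 where "b0 = onorm ((*v) A) + onorm ((*v) E) / alpha + alpha * onorm ((*v) (C0 C B K0))
    + onorm ((*v) D) + alpha * kr + alpha * onorm ((*v) (B ** K2)) + kr + alpha + 2"
  define a1 where "a1 = 2 * kP * k0 / alpha"
  define b1 where "b1 = 2 * kP * (kr + 2) / sqrt alpha"
  have "0 \<le> kr" and "0 \<le> k0" and "0 \<le> kP"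
    using F_nonneg by (auto simp: kr_def k0_def kP_def onorm_matrix_nonneg)
  then have "0 \<le> a0" and "0 \<le> b0" and "0 \<le> a1" and "0 \<le> b1"
    using alpha_pos onorm_matrix_nonneg[of A] onorm_matrix_nonneg[of E] onorm_matrix_nonneg[of D]
      onorm_matrix_nonneg[of "C0 C B K0"] onorm_matrix_nonneg[of "B ** K2"]
    by (simp_all add: a0_def b0_def a1_def b1_def)
  show ?thesis
  proof (rule that[of "a0 + a1" "b0 + b1"])
    fix \<zeta> \<sigma> z d\<zeta> d\<sigma> dz
    assume loop: "near_linear_loop \<zeta> \<sigma> z d\<zeta> d\<sigma> dz"
    let ?n = "norm (lyap_coords (\<zeta>, vcat \<sigma> z))"
    have "0 \<le> b1 * ?n" and "0 \<le> a0 * ?n" and "0 \<le> b0 * ?n * sqrt ?n"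
      using \<open>0 \<le> b1\<close> \<open>0 \<le> a0\<close> \<open>0 \<le> b0\<close> by simp_all
    with near_linear_loop_growth[OF loop] near_linear_loop_lyapunov_le[OF loop] \<open>0 \<le> a1\<close>
    show "norm (lyap_coords (d\<zeta>, vcat d\<sigma> dz)) \<le> a0 + a1 + (b0 + b1) * ?n"
      and "2 * (lyap_coords (d\<zeta>, vcat d\<sigma> dz) \<bullet> lyap_form (lyap_coords (\<zeta>, vcat \<sigma> z)))
        \<le> - e * ?n ^ 2 + (a0 + a1) * ?n + (b0 + b1) * ?n * sqrt ?n"
      unfolding a0_def b0_def a1_def b1_def kr_def k0_def kP_def
      by (simp_all only: distrib_right mult.assoc)
  qed (use \<open>0 \<le> a0\<close> \<open>0 \<le> b0\<close> \<open>0 \<le> a1\<close> \<open>0 \<le> b1\<close> in simp_all)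
qed

lemma closed_loop_near_linear:
  assumes "closed_loop_solution A E C D B K0 K1 K2 alpha f \<zeta> \<sigma> \<eta>"
  defines "z \<equiv> \<lambda>t. \<eta> t + matrix_inv (B ** K2) *v f t"
  obtains d\<zeta> d\<sigma> dz N where "negligible N"
    and "\<And>t. 0 \<le> t \<Longrightarrow> ((\<lambda>s. (d\<zeta> s, vcat (d\<sigma> s) (dz s)))
           has_integral (\<zeta> t, vcat (\<sigma> t) (z t)) - (\<zeta> 0, vcat (\<sigma> 0) (z 0))) {0..t}"
    and "\<And>t. 0 \<le> t \<Longrightarrow> t \<notin> N \<Longrightarrow> near_linear_loop (\<zeta> t) (\<sigma> t) (z t) (d\<zeta> t) (d\<sigma> t) (dz t)"
proof -
  let ?M = "matrix_inv (B ** K2)"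
  obtain d\<zeta> d\<sigma> d\<eta> where int: "\<forall>t\<ge>0. d\<zeta> absolutely_integrable_on {0..t} \<and>
        d\<sigma> absolutely_integrable_on {0..t} \<and> d\<eta> absolutely_integrable_on {0..t} \<and>
        \<zeta> t = \<zeta> 0 + integral {0..t} d\<zeta> \<and> \<sigma> t = \<sigma> 0 + integral {0..t} d\<sigma> \<and>
        \<eta> t = \<eta> 0 + integral {0..t} d\<eta>"
    and ode: "AE t in lborel. 0 \<le> t \<longrightarrow>
         d\<zeta> t = A *v \<zeta> t + E *v \<sigma> t \<and>
         (if \<sigma> t \<noteq> 0 then
            d\<sigma> t = C *v \<zeta> t + D *v \<sigma> t
              + B *v (K0 *v \<zeta> t + cgain alpha (\<sigma> t) *\<^sub>R (K1 *v \<sigma> t) + K2 *v \<eta> t) + f t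
            \<and> d\<eta> t = (cgain alpha (\<sigma> t))\<^sup>2 *\<^sub>R \<sigma> t
          else
            d\<sigma> t = C *v \<zeta> t + D *v \<sigma> t + B *v (K0 *v \<zeta> t + K2 *v \<eta> t) + f t
            \<and> norm (d\<eta> t) \<le> 1)"
    using assms(1) unfolding closed_loop_solution_def by blast
  have ae: "AE t in lborel. 0 \<le> t \<longrightarrow> near_linear_loop (\<zeta> t) (\<sigma> t) (z t) (d\<zeta> t) (d\<sigma> t) (d\<eta> t + ?M *v f' t)"
    using ode
  proof eventually_elim
    case (elim t)
    show ?case
    proof
      assume "0 \<le> t"
      with elim show "near_linear_loop (\<zeta> t) (\<sigma> t) (z t) (d\<zeta> t) (d\<sigma> t) (d\<eta> t + ?M *v f' t)"
        unfolding z_def by (intro control_law_near_linear f'_bound) auto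
    qed
  qed
  obtain N where "negligible N"
    and loop: "\<And>t. t \<notin> N \<Longrightarrow> 0 \<le> t \<longrightarrow> near_linear_loop (\<zeta> t) (\<sigma> t) (z t) (d\<zeta> t) (d\<sigma> t) (d\<eta> t + ?M *v f' t)"
    using AE_lborel_negligible[OF ae] by blast
  have "((\<lambda>s. (d\<zeta> s, vcat (d\<sigma> s) (d\<eta> s + ?M *v f' s)))
      has_integral (\<zeta> t, vcat (\<sigma> t) (z t)) - (\<zeta> 0, vcat (\<sigma> 0) (z 0))) {0..t}" if "0 \<le> t" for t
  proof -
    from int that have "(d\<zeta> has_integral \<zeta> t - \<zeta> 0) {0..t}" and "(d\<sigma> has_integral \<sigma> t - \<sigma> 0) {0..t}"
      and "(d\<eta> has_integral \<eta> t - \<eta> 0) {0..t}"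
      by (blast intro: absolutely_integrable_has_integral_increment)+
    note increments = this
    note has_integral_derivative_increment[OF f_deriv that]
    from has_integral_linear[OF this matrix_vector_mul_bounded_linear[of ?M]]
    have "((\<lambda>s. ?M *v f' s) has_integral ?M *v (f t - f 0)) {0..t}"
      by (simp add: o_def)
    with increments(3) have "((\<lambda>s. d\<eta> s + ?M *v f' s) has_integral (\<eta> t - \<eta> 0) + ?M *v (f t - f 0)) {0..t}"
      by (rule has_integral_add)
    moreover have "(\<eta> t - \<eta> 0) + ?M *v (f t - f 0) = z t - z 0"
      by (simp add: z_def matrix_vector_mult_diff_distrib)
    ultimately have dz: "((\<lambda>s. d\<eta> s + ?M *v f' s) has_integral z t - z 0) {0..t}"
      by simp
    from has_integral_Pair[OF increments(1) has_integral_vcat[OF increments(2) dz]] show ?thesis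
      by (simp add: vcat_diff)
  qed
  with \<open>negligible N\<close> loop show ?thesis
    by (intro that) auto
qed

lemma closed_loop_reaches_sublevel:
  obtains c where "0 < c"
    and "\<And>\<zeta> \<sigma> \<eta>. closed_loop_solution A E C D B K0 K1 K2 alpha f \<zeta> \<sigma> \<eta> \<Longrightarrow>
      \<exists>T\<ge>0. lyap_coords (\<zeta> T, vcat (\<sigma> T) (\<eta> T + matrix_inv (B ** K2) *v f T))
        \<bullet> lyap_form (lyap_coords (\<zeta> T, vcat (\<sigma> T) (\<eta> T + matrix_inv (B ** K2) *v f T))) \<le> c"
proof -
  obtain a b where "0 \<le> a" and "0 \<le> b"
    and growth: "\<And>\<zeta> \<sigma> z d\<zeta> d\<sigma> dz. near_linear_loop \<zeta> \<sigma> z d\<zeta> d\<sigma> dz \<Longrightarrow>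
      norm (lyap_coords (d\<zeta>, vcat d\<sigma> dz)) \<le> a + b * norm (lyap_coords (\<zeta>, vcat \<sigma> z))"
    and derivative: "\<And>\<zeta> \<sigma> z d\<zeta> d\<sigma> dz. near_linear_loop \<zeta> \<sigma> z d\<zeta> d\<sigma> dz \<Longrightarrow>
      2 * (lyap_coords (d\<zeta>, vcat d\<sigma> dz) \<bullet> lyap_form (lyap_coords (\<zeta>, vcat \<sigma> z)))
        \<le> - e * norm (lyap_coords (\<zeta>, vcat \<sigma> z)) ^ 2 + a * norm (lyap_coords (\<zeta>, vcat \<sigma> z))
          + b * norm (lyap_coords (\<zeta>, vcat \<sigma> z)) * sqrt (norm (lyap_coords (\<zeta>, vcat \<sigma> z)))"
    using near_linear_loop_estimates by blast
  obtain c where "0 < c" and reach: "\<And>(Y :: real \<Rightarrow> _) dY N. (\<And>t. 0 \<le> t \<Longrightarrow> (dY has_integral (Y t - Y 0)) {0..t})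
      \<Longrightarrow> negligible N \<Longrightarrow> (\<And>t. 0 \<le> t \<Longrightarrow> t \<notin> N \<Longrightarrow> norm (dY t) \<le> a + b * norm (Y t))
      \<Longrightarrow> (\<And>t. 0 \<le> t \<Longrightarrow> t \<notin> N \<Longrightarrow> 2 * (dY t \<bullet> lyap_form (Y t))
              \<le> - e * norm (Y t) ^ 2 + a * norm (Y t) + b * norm (Y t) * sqrt (norm (Y t)))
      \<Longrightarrow> \<exists>t\<ge>0. Y t \<bullet> lyap_form (Y t) \<le> c"
    using quadratic_lyapunov_reaching[OF bounded_linear_lyap_form lyap_form_symmetric lyap_form_nonneg
          e_pos \<open>0 \<le> a\<close> \<open>0 \<le> b\<close>] by blast
  show ?thesis
  proof (rule that[OF \<open>0 < c\<close>])
    fix \<zeta> \<sigma> \<eta>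
    assume sol: "closed_loop_solution A E C D B K0 K1 K2 alpha f \<zeta> \<sigma> \<eta>"
    define Y where "Y t = lyap_coords (\<zeta> t, vcat (\<sigma> t) (\<eta> t + matrix_inv (B ** K2) *v f t))" for t
    show "\<exists>T\<ge>0. Y T \<bullet> lyap_form (Y T) \<le> c"
    proof (rule closed_loop_near_linear[OF sol])
      fix d\<zeta> d\<sigma> dz N
      assume "negligible N"
        and int: "\<And>t. 0 \<le> t \<Longrightarrow> ((\<lambda>s. (d\<zeta> s, vcat (d\<sigma> s) (dz s))) has_integral
            (\<zeta> t, vcat (\<sigma> t) (\<eta> t + matrix_inv (B ** K2) *v f t))
            - (\<zeta> 0, vcat (\<sigma> 0) (\<eta> 0 + matrix_inv (B ** K2) *v f 0))) {0..t}"
        and loop: "\<And>t. 0 \<le> t \<Longrightarrow> t \<notin> N \<Longrightarrow> near_linear_loop (\<zeta> t) (\<sigma> t)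
            (\<eta> t + matrix_inv (B ** K2) *v f t) (d\<zeta> t) (d\<sigma> t) (dz t)"
      define dY where "dY = (\<lambda>t. lyap_coords (d\<zeta> t, vcat (d\<sigma> t) (dz t)))"
      show "\<exists>T\<ge>0. Y T \<bullet> lyap_form (Y T) \<le> c"
      proof (rule reach[OF _ \<open>negligible N\<close>])
        show "(dY has_integral Y t - Y 0) {0..t}" if "0 \<le> t" for t
          using has_integral_linear[OF int[OF that] bounded_linear_lyap_coords]
          by (simp only: Y_def dY_def o_def linear_diff[OF bounded_linear.linear[OF bounded_linear_lyap_coords]])
        show "norm (dY t) \<le> a + b * norm (Y t)" if "0 \<le> t" "t \<notin> N" for t
          unfolding Y_def dY_def by (rule growth[OF loop[OF that]])
        show "2 * (dY t \<bullet> lyap_form (Y t))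
            \<le> - e * norm (Y t) ^ 2 + a * norm (Y t) + b * norm (Y t) * sqrt (norm (Y t))"
          if "0 \<le> t" "t \<notin> N" for t
          unfolding Y_def dY_def by (rule derivative[OF loop[OF that]])
      qed
    qed
  qed
qed

theorem residual_set:
  "\<exists>X :: ((real^'r) \<times> (real^('n + 'n))) set.
     X \<noteq> {} \<and> bounded X \<and> (0, 0) \<in> interior X \<and>
     (\<forall>zeta sg eta.
        closed_loop_solution A E C D B K0 K1 K2 alpha f zeta sg eta \<longrightarrow>
        (zeta 0, vcat (sg 0) (eta 0 + matrix_inv (B ** K2) *v f 0)) \<notin> X \<longrightarrow>
        (\<exists>T\<ge>0. (zeta T, vcat (sg T) (eta T + matrix_inv (B ** K2) *v f T)) \<in> X))"
proof -
  obtain c where "0 < c"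
    and reach: "\<And>\<zeta> \<sigma> \<eta>. closed_loop_solution A E C D B K0 K1 K2 alpha f \<zeta> \<sigma> \<eta> \<Longrightarrow>
      \<exists>T\<ge>0. lyap_coords (\<zeta> T, vcat (\<sigma> T) (\<eta> T + matrix_inv (B ** K2) *v f T))
        \<bullet> lyap_form (lyap_coords (\<zeta> T, vcat (\<sigma> T) (\<eta> T + matrix_inv (B ** K2) *v f T))) \<le> c"
    using closed_loop_reaches_sublevel by blast
  obtain m M where "0 < m" and "\<And>p. m * norm p ^ 2 \<le> lyap_coords p \<bullet> lyap_form (lyap_coords p)"
    and "\<And>p. lyap_coords p \<bullet> lyap_form (lyap_coords p) \<le> M * norm p ^ 2"
    using lyap_value_bounds by blast
  note sublevel = sublevel_set_bounded_neighbourhood[OF this \<open>0 < c\<close>]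
  define X where "X = {p. lyap_coords p \<bullet> lyap_form (lyap_coords p) \<le> c}"
  have "bounded X" and "0 \<in> interior X"
    unfolding X_def by (fact sublevel)+
  moreover have "X \<noteq> {}"
    using \<open>0 \<in> interior X\<close> interior_subset by blast
  moreover have "\<exists>T\<ge>0. (\<zeta> T, vcat (\<sigma> T) (\<eta> T + matrix_inv (B ** K2) *v f T)) \<in> X"
    if "closed_loop_solution A E C D B K0 K1 K2 alpha f \<zeta> \<sigma> \<eta>" for \<zeta> \<sigma> \<eta>
    using reach[OF that] by (simp only: X_def mem_Collect_eq)
  ultimately show ?thesis
    unfolding zero_prod_def[symmetric] by blast
qed

end

theorem corollary1:
  fixes A :: "real^'r^'r" and E :: "real^'n^'r" and C :: "real^'r^'n" and D :: "real^'n^'n"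
    and B :: "real^'m^'n" and K0 :: "real^'r^'m" and K1 K2 :: "real^'n^'m"
    and f f' :: "real \<Rightarrow> real^'n"
    and S :: "real^'r^'r" and P :: "real^('n + 'n)^('n + 'n)"
    and alpha gamma rho mu beta piz kappa :: real
  assumes hurwitz: "hurwitz A"
    and B_rank: "rank B = CARD('n)"
    and BK2_inv: "invertible (B ** K2)"
    and f_deriv: "\<forall>t\<ge>0. (f has_vector_derivative f' t) (at t within {0..})"
    and f_bound: "\<forall>t\<ge>0. norm (f' t) \<le> 1 / (onorm ((*v) (matrix_inv (B ** K2))) * gamma)"
    and alpha_pos: "alpha > 0" and gamma_pos: "gamma > 0" and rho_pos: "rho > 0"
    and Zd_pos: "pos_def (Zd mu beta piz kappa :: real^(('n + 'n) + ('n + 'n))^(('n + 'n) + ('n + 'n)))"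
    and S_pos: "pos_def S" and P_pos: "pos_def P"
    and LMI1: "neg_def (block2
                 (transpose A ** S + S ** A + rho *\<^sub>R S)
                 (transpose ((1/alpha) *\<^sub>R (transpose G0 ** transpose E ** S)))
                 ((1/alpha) *\<^sub>R (transpose G0 ** transpose E ** S))
                 (- (rho *\<^sub>R P)))"
    and LMI2: "neg_def (transpose (AK B K1 K2) ** P + P ** AK B K1 K2
                 + P ** transpose Mstack ** Zd mu beta piz kappa ** Mstack ** P
                 + transpose (Nstack B K1 K2 D gamma alpha) ** matrix_inv (Zd mu beta piz kappa)
                     ** Nstack B K1 K2 D gamma alpha
                 + rho *\<^sub>R P)"
    and LMI3: "pos_def (block2 (rho *\<^sub>R S) (transpose (C0 C B K0)) (C0 C B K0) (kappa *\<^sub>R mat 1))"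
  shows "\<exists>X :: ((real^'r) \<times> (real^('n + 'n))) set.
           X \<noteq> {} \<and> bounded X \<and> (0, 0) \<in> interior X \<and>
           (\<forall>zeta sg eta.
              closed_loop_solution A E C D B K0 K1 K2 alpha f zeta sg eta \<longrightarrow>
              (zeta 0, vcat (sg 0) (eta 0 + matrix_inv (B ** K2) *v f 0)) \<notin> X \<longrightarrow>
              (\<exists>T\<ge>0. (zeta T, vcat (sg T) (eta T + matrix_inv (B ** K2) *v f T)) \<in> X))"
proof -
  have "0 < mu" "0 < beta" "0 < piz" "0 < kappa"
    by (fact pos_def_Zd_imp_pos[OF Zd_pos])+
  obtain e where "0 < e"
    and LMI1': "\<And>z \<xi>. 2 * ((A *v z) \<bullet> (S *v z)) + rho * (z \<bullet> (S *v z))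
              + (2/alpha) * ((E *v (G0 *v \<xi>)) \<bullet> (S *v z)) - rho * (\<xi> \<bullet> (P *v \<xi>))
            \<le> - e * (norm z ^ 2 + norm \<xi> ^ 2)"
    using LMI1_quadratic[OF LMI1 pos_def_symmetric[OF S_pos]] by blast
  interpret lmi_design A E C D B K0 K1 K2 f f' S P alpha rho piz kappa e
    "1 / (onorm ((*v) (matrix_inv (B ** K2))) * gamma)"
  proof
    show "(f has_vector_derivative f' t) (at t within {0..})"
      and "norm (f' t) \<le> 1 / (onorm ((*v) (matrix_inv (B ** K2))) * gamma)" if "0 \<le> t" for t
      using f_deriv f_bound that by simp_all
    show "2 * ((AK B K1 K2 *v \<xi>) \<bullet> (P *v \<xi>)) + (piz + kappa) * norm (G0 *v (P *v \<xi>)) ^ 2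
        + norm (D *v (G0 *v \<xi>)) ^ 2 / (piz * alpha\<^sup>2) + rho * (\<xi> \<bullet> (P *v \<xi>)) \<le> 0" for \<xi>
      using LMI2_quadratic[OF LMI2 pos_def_symmetric[OF P_pos]] \<open>0 < mu\<close> \<open>0 < beta\<close> \<open>0 < piz\<close> \<open>0 < kappa\<close>
      by blast
    show "norm (C0 C B K0 *v z) ^ 2 / kappa \<le> rho * (z \<bullet> (S *v z))" for z
      by (rule LMI3_quadratic[OF LMI3 \<open>0 < kappa\<close>])
  qed (fact S_pos P_pos alpha_pos \<open>0 < piz\<close> \<open>0 < kappa\<close> \<open>0 < e\<close> BK2_inv LMI1')+
  show ?thesis
    by (rule residual_set)
qed

end
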